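(* Let $\Omega\subset\mathbb{R}^2$ be a bounded, open, connected set containing the origin $O$. Consider a singular stress field $\boldsymbol{\sigma}\in\mathcal{A}(\Omega,\mathrm{Sym})$ and a singular body force field $\boldsymbol{B}\in\mathcal{A}(\Omega,\mathbb{R}^2)$. Then: (a) The equilibrium condition $\operatorname{Div}\boldsymbol{\sigma}+\boldsymbol{B}=\boldsymbol{0}$ (in the sense of distributions on $\Omega$) implies the pointwise condition $\operatorname{div}(\boldsymbol{\sigma}|_{\Omega-O})+\boldsymbol{B}|_{\Omega-O}=\boldsymbol{0}$ on $\Omega-O$. (b) If $\deg(\boldsymbol{\sigma})<-1$ and $\deg(\boldsymbol{B})<0$, then the equilibrium condition $\operatorname{Div}\boldsymbol{\sigma}+\boldsymbol{B}=\boldsymbol{0}$ in $\Omega$ is equivalent to $\operatorname{div}(\boldsymbol{\sigma}|_{\Omega-O})+\boldsymbol{B}|_{\Omega-O}=\boldsymbol{0}$ on $\Omega-O$.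
   Context: $\Omega-O$ means $\Omega\setminus\{O\}$; $\mathrm{Sym}$ is the space of symmetric linear maps $\mathbb{R}^2\to\mathbb{R}^2$. For a finite-dimensional space $V$, $\mathcal{D}'(\Omega,V)$ is the space of $V$-valued distributions, acting on compactly supported smooth $V$-valued test functions by $\boldsymbol{T}(\boldsymbol{\phi})=T_i(\phi_i)$ or $T_{ij}(\phi_{ij})$ (summation convention). $\mathcal{A}(\Omega,V)$ is the set of $\boldsymbol{T}\in\mathcal{D}'(\Omega,V)$ with singular support contained in $\{O\}$; then $\boldsymbol{T}|_{\Omega-O}$ is given by a smooth function on $\Omega-O$ and is identified with that function. Distributional divergence of a tensor field: $\operatorname{Div}\boldsymbol{\sigma}(\boldsymbol{\psi})=-\boldsymbol{\sigma}(\nabla\boldsymbol{\psi})$, i.e. $(\operatorname{Div}\boldsymbol{\sigma})_i=\partial_j\sigma_{ij}$; $\operatorname{div}$ is the corresponding classical operator on smooth functions. Degree of divergence (with respect to $O$): choose an open ball $B_r\subset\Omega$ centred at $O$. For a test function $\phi$ on $B_r$ and $0<\lambda<1$ put $\phi_\lambda(\boldsymbol{x})=\lambda^{-2}\phi(\boldsymbol{x}/\lambda)$ and $(T|_{B_r})_\lambda(\phi)=T(\phi_\lambda)$. The scaling degree is $\operatorname{sd}(T)=\inf\{k\in\mathbb{R}:\lim_{\lambda\to0}\lambda^k(T|_{B_r})_\lambda=0 \text{ in the sense of distributions}\}$ and $\deg(T)=\operatorname{sd}(T)-2$. For vector/tensor valued distributions the same definition is used with vector/tensor valued test functions (equivalently,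 the maximum over components). *)

theory Defs
  imports "HOL-Analysis.Analysis"
begin

definition pd :: "2 \<Rightarrow> (real^2 \<Rightarrow> 'a::real_normed_vector) \<Rightarrow> real^2 \<Rightarrow> 'a" where
  "pd i f = (\<lambda>x. frechet_derivative f (at x) (axis i 1))"

(* Iterated partial derivatives are indexed by lists of directions instead of multi-indices. *)
definition pds :: "2 list \<Rightarrow> (real^2 \<Rightarrow> 'a::real_normed_vector) \<Rightarrow> real^2 \<Rightarrow> 'a" where
  "pds is f = foldr pd is f"

(* Meant for open U only: all iterated partial derivatives are then differentiable, hence
   continuous, on U, which is the usual notion of a C-infinity function. *)
definition smooth_on :: "(real^2) set \<Rightarrow> (real^2 \<Rightarrow> 'a::real_normed_vector) \<Rightarrow> bool" where
  "smooth_on U f \<longleftrightarrow> (\<forall>is. \<forall>x\<in>U. pds is f differentiable (at x))"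

(* Test functions on S with values in V, taken to be extended by 0 to the whole plane. *)
definition test_funs :: "(real^2) set \<Rightarrow> 'a set \<Rightarrow> (real^2 \<Rightarrow> 'a::real_normed_vector) set" where
  "test_funs S V = {\<phi>. smooth_on UNIV \<phi> \<and> range \<phi> \<subseteq> V \<and>
     compact (closure {x. \<phi> x \<noteq> 0}) \<and> closure {x. \<phi> x \<noteq> 0} \<subseteq> S}"

(* A distribution with values in a subspace V is a linear map from scalar test functions to V
   that is continuous, expressed by the usual seminorm estimate on each compact subset. Only its
   values on test functions on \<Omega> are meaningful. *)
definition distributions ::
  "(real^2) set \<Rightarrow> 'a set \<Rightarrow> ((real^2 \<Rightarrow> real) \<Rightarrow> 'a::euclidean_space) set" where
  "distributions \<Omega> V = {T.
     (\<forall>\<phi>\<in>test_funs \<Omega> UNIV. T \<phi> \<in> V) \<and>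
     (\<forall>\<phi>\<in>test_funs \<Omega> UNIV. \<forall>\<psi>\<in>test_funs \<Omega> UNIV. T (\<lambda>x. \<phi> x + \<psi> x) = T \<phi> + T \<psi>) \<and>
     (\<forall>c. \<forall>\<phi>\<in>test_funs \<Omega> UNIV. T (\<lambda>x. c * \<phi> x) = c *\<^sub>R T \<phi>) \<and>
     (\<forall>K. compact K \<and> K \<subseteq> \<Omega> \<longrightarrow>
        (\<exists>C N. \<forall>\<phi>\<in>test_funs K UNIV.
           norm (T \<phi>) \<le> C * (\<Sum>is\<in>{is. length is \<le> N}. SUP x. \<bar>pds is \<phi> x\<bar>)))}"

(* The action on vector-valued test functions: T(\<phi>) is the sum of T_b(\<phi>_b) over the components
   with respect to the standard basis, where T_b = T(.) \<bullet> b. *)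
definition act :: "((real^2 \<Rightarrow> real) \<Rightarrow> 'a::euclidean_space) \<Rightarrow> (real^2 \<Rightarrow> 'a) \<Rightarrow> real" where
  "act T \<phi> = (\<Sum>b\<in>Basis. T (\<lambda>x. \<phi> x \<bullet> b) \<bullet> b)"

definition represents_on ::
  "(real^2) set \<Rightarrow> (real^2 \<Rightarrow> 'a) \<Rightarrow> ((real^2 \<Rightarrow> real) \<Rightarrow> 'a::euclidean_space) \<Rightarrow> bool" where
  "represents_on U f T \<longleftrightarrow> smooth_on U f \<and>
     (\<forall>\<phi>\<in>test_funs U UNIV. T \<phi> = (LINT x|lborel. \<phi> x *\<^sub>R f x))"

definition singular_support ::
  "(real^2) set \<Rightarrow> ((real^2 \<Rightarrow> real) \<Rightarrow> 'a::euclidean_space) \<Rightarrow> (real^2) set" where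
  "singular_support \<Omega> T =
     {x\<in>\<Omega>. \<not> (\<exists>U f. open U \<and> x \<in> U \<and> U \<subseteq> \<Omega> \<and> represents_on U f T)}"

definition \<A> :: "(real^2) set \<Rightarrow> 'a set \<Rightarrow> ((real^2 \<Rightarrow> real) \<Rightarrow> 'a::euclidean_space) set" where
  "\<A> \<Omega> V = {T \<in> distributions \<Omega> V. singular_support \<Omega> T \<subseteq> {0}}"

(* For T in \<A> \<Omega> V such a function exists, and its values on \<Omega> - {0} are unique; the values
   elsewhere are arbitrary. *)
definition regular_part ::
  "(real^2) set \<Rightarrow> ((real^2 \<Rightarrow> real) \<Rightarrow> 'a::euclidean_space) \<Rightarrow> real^2 \<Rightarrow> 'a" where
  "regular_part \<Omega> T = (SOME f. represents_on (\<Omega> - {0}) f T)"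

definition rescale :: "real \<Rightarrow> (real^2 \<Rightarrow> 'a::real_normed_vector) \<Rightarrow> real^2 \<Rightarrow> 'a" where
  "rescale l \<phi> = (\<lambda>x. (1 / l\<^sup>2) *\<^sub>R \<phi> (x /\<^sub>R l))"

(* The value does not depend on the chosen ball. It is extended real because the infimum
   is -\<infinity> for, e.g., the zero distribution. *)
definition scaling_degree ::
  "(real^2) set \<Rightarrow> 'a set \<Rightarrow> ((real^2 \<Rightarrow> real) \<Rightarrow> 'a::euclidean_space) \<Rightarrow> ereal" where
  "scaling_degree \<Omega> V T =
     (let r = (SOME r. 0 < r \<and> ball 0 r \<subseteq> \<Omega>) in
      Inf (ereal ` {k. \<forall>\<phi>\<in>test_funs (ball 0 r) V.
             ((\<lambda>l. l powr k * act T (rescale l \<phi>)) \<longlongrightarrow> 0) (at_right 0)}))"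

definition div_degree ::
  "(real^2) set \<Rightarrow> 'a set \<Rightarrow> ((real^2 \<Rightarrow> real) \<Rightarrow> 'a::euclidean_space) \<Rightarrow> ereal" where
  "div_degree \<Omega> V T = scaling_degree \<Omega> V T - 2"

definition Sym :: "(real^2^2) set" where
  "Sym = {A. transpose A = A}"

definition grad :: "(real^2 \<Rightarrow> real^2) \<Rightarrow> real^2 \<Rightarrow> real^2^2" where
  "grad \<psi> = (\<lambda>x. \<chi> i j. pd j (\<lambda>y. \<psi> y $ i) x)"

definition div_field :: "(real^2 \<Rightarrow> real^2^2) \<Rightarrow> real^2 \<Rightarrow> real^2" where
  "div_field s = (\<lambda>x. \<chi> i. \<Sum>j\<in>UNIV. pd j (\<lambda>y. s y $ i $ j) x)"

(* Componentwise (Div \<sigma>)_i = \<partial>_j \<sigma>_ij, with \<partial>_j T (\<phi>) = - T (\<partial>_j \<phi>). *)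
definition Div :: "((real^2 \<Rightarrow> real) \<Rightarrow> real^2^2) \<Rightarrow> (real^2 \<Rightarrow> real) \<Rightarrow> real^2" where
  "Div \<sigma> = (\<lambda>\<phi>. \<chi> i. \<Sum>j\<in>UNIV. - (\<sigma> (pd j \<phi>) $ i $ j))"

lemma act_vector:
  "act (T :: (real^2 \<Rightarrow> real) \<Rightarrow> real^2) \<psi> = (\<Sum>i\<in>UNIV. T (\<lambda>x. \<psi> x $ i) $ i)"
  by (simp add: act_def Basis_vec_def inner_axis UNION_singleton_eq_range sum.reindex inj_on_def axis_eq_axis)

lemma act_tensor:
  "act (T :: (real^2 \<Rightarrow> real) \<Rightarrow> real^2^2) \<phi> =
     (\<Sum>i\<in>UNIV. \<Sum>j\<in>UNIV. T (\<lambda>x. \<phi> x $ i $ j) $ i $ j)"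
proof -
  have B: "(Basis :: (real^2^2) set) = (\<lambda>(i, j). axis i (axis j 1)) ` (UNIV \<times> UNIV)"
    by (auto simp: Basis_vec_def)
  have "inj_on (\<lambda>(i, j). axis i (axis j (1::real)) :: real^2^2) (UNIV \<times> UNIV)"
    by (auto simp: inj_on_def axis_eq_axis)
  then show ?thesis
    unfolding act_def B
    by (simp add: sum.reindex sum.cartesian_product inner_axis case_prod_unfold)
qed

lemma act_Div: "act (Div \<sigma>) \<psi> = - act \<sigma> (grad \<psi>)"
  by (simp add: act_vector act_tensor Div_def grad_def sum_negf)

definition equilibrium ::
  "(real^2) set \<Rightarrow> ((real^2 \<Rightarrow> real) \<Rightarrow> real^2^2) \<Rightarrow> ((real^2 \<Rightarrow> real) \<Rightarrow> real^2) \<Rightarrow> bool" where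
  "equilibrium \<Omega> \<sigma> B \<longleftrightarrow> (\<forall>\<psi>\<in>test_funs \<Omega> UNIV. act (Div \<sigma>) \<psi> + act B \<psi> = 0)"

definition pointwise_equilibrium ::
  "(real^2) set \<Rightarrow> ((real^2 \<Rightarrow> real) \<Rightarrow> real^2^2) \<Rightarrow> ((real^2 \<Rightarrow> real) \<Rightarrow> real^2) \<Rightarrow> bool" where
  "pointwise_equilibrium \<Omega> \<sigma> B \<longleftrightarrow>
     (\<forall>x\<in>\<Omega> - {0}. div_field (regular_part \<Omega> \<sigma>) x + regular_part \<Omega> B x = 0)"

end

theory Submission
  imports Defs "HOL-Computational_Algebra.Polynomial"
begin

text \<open>
  Put \<open>T = Div \<sigma> + B\<close>. By integration by parts, \<open>T\<close> is given on \<open>\<Omega> - {0}\<close> by the smooth function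
  \<open>div s + b\<close>, where \<open>s\<close> and \<open>b\<close> are the regular parts of \<open>\<sigma>\<close> and \<open>B\<close>. The fundamental lemma of the
  calculus of variations therefore identifies pointwise equilibrium with the vanishing of \<open>T\<close> on
  test functions supported away from the origin (\<open>pointwise_equilibrium_iff_away_from_0\<close>). This
  gives (a), and reduces (b) to the claim that a distribution \<open>T\<close> supported at the origin is zero
  if the degrees of \<open>\<sigma>\<close> and \<open>B\<close> are below \<open>-1\<close> and \<open>0\<close>.

  Write \<open>\<phi>(\<cdot>/l)\<close> for the dilated function. The degree bounds imply that
  \<open>T (\<phi>(\<cdot>/l)) \<rightarrow> 0\<close> as \<open>l \<rightarrow> 0\<close>: the derivative in \<open>Div\<close> produces one factor \<open>1/l\<close>, which accounts
  for the difference between the two thresholds (\<open>tendsto_Div_plus_dilate\<close>). By the structure theorem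
  \<open>T\<close> would be a finite combination of derivatives of the delta distribution, and only the zero
  combination has this property. The structure theorem and Taylor polynomials can be bypassed by a
  descending induction on the order \<open>m\<close> to which \<open>\<phi>\<close> vanishes at the origin
  (\<open>functional_supported_at_0_eq_0\<close>).
  If \<open>m\<close> exceeds the order \<open>N\<close> of \<open>T\<close>, cut \<open>\<phi>\<close> off at scale \<open>l\<close>: this does not change \<open>T \<phi>\<close>, and
  the seminorms of order up to \<open>N\<close> of the result tend to 0. If \<open>\<phi>\<close> vanishes to order \<open>m\<close>, then
  \<open>l\<^sup>m \<phi>(\<cdot>/l) - \<phi>\<close> vanishes to order \<open>m + 1\<close>, because dilation multiplies derivatives of order \<open>m\<close>
  at 0 by \<open>l\<^sup>-\<^sup>m\<close>. Inductively \<open>T \<phi> = l\<^sup>m T (\<phi>(\<cdot>/l)) \<rightarrow> 0\<close>. The case \<open>m = 0\<close> is the claim.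

  Smooth cutoff functions, integration by parts in the plane, the fundamental lemma, and the gluing
  of the local densities of a distribution into its regular part are developed on the way.
\<close>

section \<open>Smooth functions of two variables\<close>

lemma pds_Nil [simp]: "pds [] f = f"
  by (simp add: pds_def)

lemma pds_Cons: "pds (i # is) f = pd i (pds is f)"
  by (simp add: pds_def)

lemma pds_snoc: "pds (is @ [i]) f = pds is (pd i f)"
  by (simp add: pds_def)

lemma pds_append: "pds (is @ js) f = pds is (pds js f)"
  by (simp add: pds_def)

lemma pd_eq: "(f has_derivative f') (at x) \<Longrightarrow> pd i f x = f' (axis i 1)"
  by (metis frechet_derivative_at pd_def)

lemma pd_cong:
  assumes "open U" "x \<in> U" "\<And>y. y \<in> U \<Longrightarrow> f y = g y"
  shows "pd i f x = pd i g x"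
proof -
  have "(f has_derivative D) (at x) \<longleftrightarrow> (g has_derivative D) (at x)" for D
    using has_derivative_transform_within_open[of f D x UNIV U g]
      has_derivative_transform_within_open[of g D x UNIV U f] assms by auto
  then show ?thesis
    by (simp add: pd_def frechet_derivative_def)
qed

lemma differentiable_cong:
  assumes "open U" "x \<in> U" "\<And>y. y \<in> U \<Longrightarrow> f y = g y"
  shows "f differentiable (at x) \<longleftrightarrow> g differentiable (at x)"
  using has_derivative_transform_within_open[of f _ x UNIV U g]
    has_derivative_transform_within_open[of g _ x UNIV U f] assms
  unfolding differentiable_def by metis

lemma pds_cong:
  assumes "open U" "x \<in> U" "\<And>y. y \<in> U \<Longrightarrow> f y = g y"
  shows "pds is f x = pds is g x"
  using assms(2)
proof (induction "is" arbitrary: x)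
  case Nil
  then show ?case using assms by simp
next
  case (Cons i "is")
  then show ?case
    unfolding pds_Cons by (intro pd_cong[OF assms(1)]) auto
qed

text \<open>Closure properties of \<^const>\<open>smooth_on\<close> are proved by induction on the number of available
  derivatives, since the first derivative of a product or composition again has this shape.\<close>

definition differentiable_upto :: "nat \<Rightarrow> (real^2) set \<Rightarrow> (real^2 \<Rightarrow> 'a::real_normed_vector) \<Rightarrow> bool" where
  "differentiable_upto n U f \<longleftrightarrow> (\<forall>is. length is \<le> n \<longrightarrow> (\<forall>x\<in>U. pds is f differentiable (at x)))"

lemma smooth_on_iff_upto: "smooth_on U f \<longleftrightarrow> (\<forall>n. differentiable_upto n U f)"
  unfolding smooth_on_def differentiable_upto_def by auto

lemma differentiable_upto_0: "differentiable_upto 0 U f \<longleftrightarrow> (\<forall>x\<in>U. f differentiable (at x))"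
  by (simp add: differentiable_upto_def)

lemma differentiable_upto_Suc:
  "differentiable_upto (Suc n) U f \<longleftrightarrow>
     (\<forall>x\<in>U. f differentiable (at x)) \<and> (\<forall>i. differentiable_upto n U (pd i f))"
proof -
  have "(\<forall>is::2 list. length is \<le> Suc n \<longrightarrow> P is) \<longleftrightarrow>
      P [] \<and> (\<forall>i is. length is \<le> n \<longrightarrow> P (is @ [i]))" for P
  proof (intro iffI allI impI)
    fix "is" :: "2 list"
    assume "P [] \<and> (\<forall>i is. length is \<le> n \<longrightarrow> P (is @ [i]))" "length is \<le> Suc n"
    then show "P is" by (cases "is" rule: rev_cases) auto
  qed auto
  from this[of "\<lambda>is. \<forall>x\<in>U. pds is f differentiable (at x)"] show ?thesis
    unfolding differentiable_upto_def pds_snoc by auto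
qed

lemma differentiable_upto_SucD: "differentiable_upto (Suc n) U f \<Longrightarrow> differentiable_upto n U f"
  by (auto simp: differentiable_upto_def)

lemma differentiable_upto_cong:
  assumes "open U" "\<And>y. y \<in> U \<Longrightarrow> f y = g y"
  shows "differentiable_upto n U f \<longleftrightarrow> differentiable_upto n U g"
proof -
  have "pds is f differentiable (at x) \<longleftrightarrow> pds is g differentiable (at x)" if "x \<in> U" for "is" x
    by (rule differentiable_cong[OF assms(1) that]) (metis assms pds_cong)
  then show ?thesis by (simp add: differentiable_upto_def)
qed

lemma smooth_on_cong:
  assumes "open U" "\<And>y. y \<in> U \<Longrightarrow> f y = g y"
  shows "smooth_on U f \<longleftrightarrow> smooth_on U g"
  using differentiable_upto_cong[OF assms] by (simp add: smooth_on_iff_upto)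

lemma smooth_on_subset: "smooth_on U f \<Longrightarrow> V \<subseteq> U \<Longrightarrow> smooth_on V f"
  by (auto simp: smooth_on_def)

lemma smooth_on_imp_differentiable: "smooth_on U f \<Longrightarrow> x \<in> U \<Longrightarrow> f differentiable (at x)"
  by (metis smooth_on_def pds_Nil)

lemma smooth_on_pds: "smooth_on U f \<Longrightarrow> smooth_on U (pds is f)"
  by (simp add: smooth_on_def pds_append[symmetric])

lemma smooth_on_pd: "smooth_on U f \<Longrightarrow> smooth_on U (pd i f)"
  using smooth_on_pds[of U f "[i]"] by (simp add: pds_Cons)

lemma smooth_on_imp_continuous_on: "smooth_on U f \<Longrightarrow> continuous_on U f"
  by (meson continuous_at_imp_continuous_on differentiable_imp_continuous_within
      smooth_on_imp_differentiable)

subsection \<open>Closure properties and differentiation rules\<close>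

lemma pd_bounded_linear:
  assumes "bounded_linear L" "f differentiable (at x)"
  shows "pd i (\<lambda>x. L (f x)) x = L (pd i f x)"
proof -
  from assms(2) have "(f has_derivative frechet_derivative f (at x)) (at x)"
    using frechet_derivative_works by blast
  from bounded_linear.has_derivative[OF assms(1) this] show ?thesis
    by (subst pd_eq) (auto simp: pd_def)
qed

lemma differentiable_bounded_linear:
  "bounded_linear L \<Longrightarrow> f differentiable (at x) \<Longrightarrow> (\<lambda>x. L (f x)) differentiable (at x)"
  unfolding differentiable_def using bounded_linear.has_derivative by blast

lemma smooth_on_bounded_linear:
  assumes "open U" "bounded_linear L" "smooth_on U f"
  shows "smooth_on U (\<lambda>x. L (f x))"
proof -
  have "differentiable_upto n U f \<Longrightarrow> differentiable_upto n U (\<lambda>x. L (f x))" for n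
  proof (induction n arbitrary: f)
    case 0
    then show ?case by (simp add: differentiable_upto_0 differentiable_bounded_linear[OF assms(2)])
  next
    case (Suc n)
    have "differentiable_upto n U (pd i (\<lambda>x. L (f x)))" for i
    proof (subst differentiable_upto_cong[OF assms(1)])
      show "pd i (\<lambda>x. L (f x)) y = L (pd i f y)" if "y \<in> U" for y
        using Suc.prems that by (intro pd_bounded_linear[OF assms(2)]) (simp add: differentiable_upto_Suc)
      show "differentiable_upto n U (\<lambda>x. L (pd i f x))"
        using Suc by (simp add: differentiable_upto_Suc)
    qed
    then show ?case
      using Suc.prems by (simp add: differentiable_upto_Suc differentiable_bounded_linear[OF assms(2)])
  qed
  then show ?thesis using assms(3) by (simp add: smooth_on_iff_upto)
qed

lemma pds_bounded_linear:
  assumes "bounded_linear L" "smooth_on UNIV f"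
  shows "pds is (\<lambda>x. L (f x)) = (\<lambda>x. L (pds is f x))"
proof (induction "is")
  case (Cons i "is")
  show ?case
    unfolding pds_Cons Cons.IH using assms(2)
    by (intro ext pd_bounded_linear[OF assms(1)]) (simp add: smooth_on_def)
qed simp

lemma pd_add:
  assumes "f differentiable (at x)" "g differentiable (at x)"
  shows "pd i (\<lambda>x. f x + g x) x = pd i f x + pd i g x"
proof -
  have "((\<lambda>x. f x + g x) has_derivative
      (\<lambda>h. frechet_derivative f (at x) h + frechet_derivative g (at x) h)) (at x)"
    using assms frechet_derivative_works by (intro has_derivative_add) blast+
  from pd_eq[OF this, of i] show ?thesis by (simp add: pd_def)
qed

lemma differentiable_upto_add:
  assumes "open U" "differentiable_upto n U f" "differentiable_upto n U g"
  shows "differentiable_upto n U (\<lambda>x. f x + g x)"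
  using assms(2,3)
proof (induction n arbitrary: f g)
  case 0
  then show ?case by (simp add: differentiable_upto_0)
next
  case (Suc n)
  have "differentiable_upto n U (pd i (\<lambda>x. f x + g x))" for i
  proof (subst differentiable_upto_cong[OF assms(1)])
    show "pd i (\<lambda>x. f x + g x) y = pd i f y + pd i g y" if "y \<in> U" for y
      using Suc.prems that by (intro pd_add) (auto simp: differentiable_upto_Suc)
    show "differentiable_upto n U (\<lambda>x. pd i f x + pd i g x)"
      using Suc by (simp add: differentiable_upto_Suc)
  qed
  then show ?case using Suc.prems by (simp add: differentiable_upto_Suc)
qed

lemma smooth_on_add:
  "open U \<Longrightarrow> smooth_on U f \<Longrightarrow> smooth_on U g \<Longrightarrow> smooth_on U (\<lambda>x. f x + g x)"
  by (simp add: smooth_on_iff_upto differentiable_upto_add)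

lemma pds_add:
  assumes "smooth_on UNIV f" "smooth_on UNIV g"
  shows "pds is (\<lambda>x. f x + g x) = (\<lambda>x. pds is f x + pds is g x)"
proof (induction "is")
  case (Cons i "is")
  show ?case
    unfolding pds_Cons Cons.IH using assms
    by (intro ext pd_add) (simp_all add: smooth_on_def)
qed simp

lemma pd_mult:
  fixes f g :: "real^2 \<Rightarrow> real"
  assumes "f differentiable (at x)" "g differentiable (at x)"
  shows "pd i (\<lambda>x. f x * g x) x = pd i f x * g x + f x * pd i g x"
proof -
  have "((\<lambda>x. f x * g x) has_derivative
      (\<lambda>h. f x * frechet_derivative g (at x) h + frechet_derivative f (at x) h * g x)) (at x)"
    using assms frechet_derivative_works by (intro has_derivative_mult) blast+
  from pd_eq[OF this, of i] show ?thesis by (simp add: pd_def)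
qed

lemma differentiable_upto_mult:
  fixes f g :: "real^2 \<Rightarrow> real"
  assumes "open U" "differentiable_upto n U f" "differentiable_upto n U g"
  shows "differentiable_upto n U (\<lambda>x. f x * g x)"
  using assms(2,3)
proof (induction n arbitrary: f g)
  case 0
  then show ?case by (simp add: differentiable_upto_0)
next
  case (Suc n)
  have "differentiable_upto n U (pd i (\<lambda>x. f x * g x))" for i
  proof (subst differentiable_upto_cong[OF assms(1)])
    show "pd i (\<lambda>x. f x * g x) y = pd i f y * g y + f y * pd i g y" if "y \<in> U" for y
      using Suc.prems that by (intro pd_mult) (auto simp: differentiable_upto_Suc)
    have "differentiable_upto n U (\<lambda>x. pd i f x * g x)" "differentiable_upto n U (\<lambda>x. f x * pd i g x)"
      using Suc.prems Suc.prems[THEN differentiable_upto_SucD]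
      by (auto intro!: Suc.IH simp: differentiable_upto_Suc)
    then show "differentiable_upto n U (\<lambda>x. pd i f x * g x + f x * pd i g x)"
      by (rule differentiable_upto_add[OF assms(1)])
  qed
  then show ?case using Suc.prems by (simp add: differentiable_upto_Suc)
qed

lemma smooth_on_mult:
  fixes f g :: "real^2 \<Rightarrow> real"
  shows "open U \<Longrightarrow> smooth_on U f \<Longrightarrow> smooth_on U g \<Longrightarrow> smooth_on U (\<lambda>x. f x * g x)"
  by (simp add: smooth_on_iff_upto differentiable_upto_mult)

lemma pd_const [simp]: "pd i (\<lambda>x. c) = (\<lambda>x. 0)"
  by (rule ext, subst pd_eq[OF has_derivative_const]) simp

lemma smooth_on_const: "smooth_on U (\<lambda>x. c)"
proof -
  have "differentiable_upto n U (\<lambda>x. c)" for n and c :: 'a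
    by (induction n arbitrary: c) (auto simp: differentiable_upto_0 differentiable_upto_Suc)
  then show ?thesis by (simp add: smooth_on_iff_upto)
qed

lemma smooth_on_cmult:
  fixes f :: "real^2 \<Rightarrow> real"
  shows "open U \<Longrightarrow> smooth_on U f \<Longrightarrow> smooth_on U (\<lambda>x. c * f x)"
  by (intro smooth_on_mult smooth_on_const)

lemma pds_cmult:
  fixes f :: "real^2 \<Rightarrow> real"
  shows "smooth_on UNIV f \<Longrightarrow> pds is (\<lambda>x. c * f x) = (\<lambda>x. c * pds is f x)"
  by (rule pds_bounded_linear[OF bounded_linear_mult_right])

lemma smooth_on_id: "smooth_on U (\<lambda>x. x)"
proof -
  have "pd i (\<lambda>x. x) = (\<lambda>x. axis i 1)" for i
    by (rule ext, subst pd_eq[OF has_derivative_ident]) simp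
  then have "differentiable_upto n U (\<lambda>x. x)" for n
    using smooth_on_const[of U "axis i 1 :: real^2" for i]
    by (cases n) (auto simp: differentiable_upto_0 differentiable_upto_Suc smooth_on_iff_upto)
  then show ?thesis by (simp add: smooth_on_iff_upto)
qed

text \<open>The sequence \<open>g\<close> lists the successive derivatives of \<open>g 0\<close>; each of them has to be treated at once,
  because differentiating \<open>g k \<circ> u\<close> leads to \<open>g (Suc k) \<circ> u\<close>.\<close>

lemma smooth_on_compose_real:
  fixes g :: "nat \<Rightarrow> real \<Rightarrow> real"
  assumes "open U" "smooth_on U u" "\<And>k t. (g k has_real_derivative g (Suc k) t) (at t)"
  shows "smooth_on U (\<lambda>x. g k (u x))"
proof -
  have D: "((\<lambda>x. g k (u x)) has_derivative (\<lambda>h. g (Suc k) (u x) * frechet_derivative u (at x) h)) (at x)"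
    if "x \<in> U" for x k
  proof -
    have u: "(u has_derivative frechet_derivative u (at x)) (at x)"
      using smooth_on_imp_differentiable[OF assms(2) that] frechet_derivative_works by blast
    have g: "(g k has_derivative (\<lambda>h. g (Suc k) (u x) * h)) (at (u x))"
      using assms(3)[of k "u x"] by (simp add: has_field_derivative_def)
    show ?thesis
      by (rule has_derivative_compose[OF u g])
  qed
  have "differentiable_upto n U (\<lambda>x. g k (u x))" for n
  proof (induction n arbitrary: k)
    case 0
    then show ?case using D by (auto simp: differentiable_upto_0 differentiable_def)
  next
    case (Suc n)
    have "differentiable_upto n U (pd i (\<lambda>x. g k (u x)))" for i
    proof (subst differentiable_upto_cong[OF assms(1)])
      show "pd i (\<lambda>x. g k (u x)) y = g (Suc k) (u y) * pd i u y" if "y \<in> U" for y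
        by (subst pd_eq[OF D[OF that]]) (simp add: pd_def)
      show "differentiable_upto n U (\<lambda>x. g (Suc k) (u x) * pd i u x)"
        using Suc smooth_on_pd[OF assms(2)]
        by (intro differentiable_upto_mult[OF assms(1)]) (auto simp: smooth_on_iff_upto)
    qed
    then show ?case using D by (auto simp: differentiable_upto_Suc differentiable_def)
  qed
  then show ?thesis by (simp add: smooth_on_iff_upto)
qed

lemma smooth_on_inverse:
  fixes f :: "real^2 \<Rightarrow> real"
  assumes "open U" "smooth_on U f" "\<And>x. x \<in> U \<Longrightarrow> f x \<noteq> 0"
  shows "smooth_on U (\<lambda>x. inverse (f x))"
proof -
  have D: "((\<lambda>x. inverse (f x)) has_derivative
      (\<lambda>h. - (inverse (f x) * frechet_derivative f (at x) h * inverse (f x)))) (at x)" if "x \<in> U" for x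
    using smooth_on_imp_differentiable[OF assms(2) that] assms(3)[OF that]
    by (intro Deriv.has_derivative_inverse) (simp_all add: frechet_derivative_works)
  have "differentiable_upto n U (\<lambda>x. inverse (f x))" for n
  proof (induction n)
    case 0
    then show ?case using D by (auto simp: differentiable_upto_0 differentiable_def)
  next
    case (Suc n)
    have "differentiable_upto n U (pd i (\<lambda>x. inverse (f x)))" for i
    proof (subst differentiable_upto_cong[OF assms(1)])
      show "pd i (\<lambda>x. inverse (f x)) y = (-1 * pd i f y) * (inverse (f y) * inverse (f y))"
        if "y \<in> U" for y
        by (subst pd_eq[OF D[OF that]]) (simp add: pd_def)
      show "differentiable_upto n U (\<lambda>x. (-1 * pd i f x) * (inverse (f x) * inverse (f x)))"
        using smooth_on_cmult[OF assms(1) smooth_on_pd[OF assms(2)], of "-1"]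
        by (intro differentiable_upto_mult[OF assms(1) _ differentiable_upto_mult[OF assms(1) Suc Suc]])
          (simp add: smooth_on_iff_upto)
    qed
    then show ?case using D by (auto simp: differentiable_upto_Suc differentiable_def)
  qed
  then show ?thesis by (simp add: smooth_on_iff_upto)
qed

lemma pd_affine:
  assumes "f differentiable (at (c *\<^sub>R (x - a)))"
  shows "(\<lambda>x. f (c *\<^sub>R (x - a))) differentiable (at x)"
    and "pd i (\<lambda>x. f (c *\<^sub>R (x - a))) x = c *\<^sub>R pd i f (c *\<^sub>R (x - a))"
proof -
  define D where "D = frechet_derivative f (at (c *\<^sub>R (x - a)))"
  have F: "(f has_derivative D) (at (c *\<^sub>R (x - a)))"
    using assms frechet_derivative_works D_def by blast
  have A: "((\<lambda>x. c *\<^sub>R (x - a)) has_derivative (\<lambda>h. c *\<^sub>R h)) (at x)"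
    by (auto intro!: derivative_eq_intros)
  have FA: "((\<lambda>x. f (c *\<^sub>R (x - a))) has_derivative (\<lambda>h. D (c *\<^sub>R h))) (at x)"
    by (rule has_derivative_compose[OF A F])
  show "(\<lambda>x. f (c *\<^sub>R (x - a))) differentiable (at x)"
    by (rule differentiableI[OF FA])
  show "pd i (\<lambda>x. f (c *\<^sub>R (x - a))) x = c *\<^sub>R pd i f (c *\<^sub>R (x - a))"
    by (simp add: pd_eq[OF FA] pd_eq[OF F] linear_cmul[OF has_derivative_linear[OF F]])
qed

lemma pds_affine:
  assumes "smooth_on UNIV f"
  shows "pds is (\<lambda>x. f (c *\<^sub>R (x - a))) = (\<lambda>x. c ^ length is *\<^sub>R pds is f (c *\<^sub>R (x - a)))"
proof (induction "is")
  case (Cons i "is")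
  have d: "pds is f differentiable (at y)" for y
    using assms by (simp add: smooth_on_def)
  show ?case
    unfolding pds_Cons Cons.IH
  proof
    fix x
    have "(\<lambda>x. pds is f (c *\<^sub>R (x - a))) differentiable (at x)"
      by (rule pd_affine(1)[OF d])
    then show "pd i (\<lambda>x. c ^ length is *\<^sub>R pds is f (c *\<^sub>R (x - a))) x =
        c ^ length (i # is) *\<^sub>R pd i (pds is f) (c *\<^sub>R (x - a))"
      by (simp add: pd_bounded_linear[OF bounded_linear_scaleR_right] pd_affine(2)[OF d])
  qed
qed simp

lemma smooth_on_affine:
  assumes "smooth_on UNIV f"
  shows "smooth_on UNIV (\<lambda>x. f (c *\<^sub>R (x - a)))"
proof -
  have "(\<lambda>x. pds is f (c *\<^sub>R (x - a))) differentiable (at x)" for "is" x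
    using assms by (intro pd_affine(1)) (simp add: smooth_on_def)
  then show ?thesis
    unfolding smooth_on_def pds_affine[OF assms]
    by (auto intro!: differentiable_bounded_linear[OF bounded_linear_scaleR_right])
qed

subsection \<open>A smooth cutoff function\<close>

text \<open>These functions, which extend \<open>exp (-1/t)\<close> times a polynomial in \<open>1/t\<close> by 0, form a class closed
  under differentiation.\<close>

definition flat_exp :: "real poly \<Rightarrow> real \<Rightarrow> real" where
  "flat_exp p t = (if t > 0 then poly p (1 / t) * exp (- (1 / t)) else 0)"

text \<open>The power \<open>y ^ k\<close> makes the induction over the polynomial work: it absorbs the factor that is split
  off from the tail of the coefficient list.\<close>

lemma poly_over_exp_tendsto_0: "((\<lambda>y::real. y ^ k * poly p y / exp y) \<longlongrightarrow> 0) at_top"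
proof (induction p arbitrary: k)
  case (pCons a p)
  have "((\<lambda>y. a * (y ^ k / exp y) + y ^ Suc k * poly p y / exp y) \<longlongrightarrow> a * 0 + 0) at_top"
    by (intro tendsto_intros tendsto_power_div_exp_0 pCons.IH)
  then show ?case by (simp add: field_simps)
qed simp

lemma flat_exp_has_derivative:
  "(flat_exp p has_real_derivative flat_exp ([:0, 0, 1:] * (p - pderiv p)) t) (at t)"
proof -
  consider "t > 0" | "t < 0" | "t = 0" by linarith
  then show ?thesis
  proof cases
    case 1
    have P: "((\<lambda>t. poly p (1 / t)) has_real_derivative poly (pderiv p) (1 / t) * (- (1 / t ^ 2))) (at t)"
      using 1 by (intro DERIV_chain2[OF poly_DERIV])
        (auto intro!: derivative_eq_intros simp: power2_eq_square field_simps)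
    have E: "((\<lambda>t. exp (- (1 / t))) has_real_derivative exp (- (1 / t)) * (1 / t ^ 2)) (at t)"
      using 1 by (auto intro!: derivative_eq_intros simp: power2_eq_square field_simps)
    have "((\<lambda>t. poly p (1 / t) * exp (- (1 / t))) has_real_derivative
        flat_exp ([:0, 0, 1:] * (p - pderiv p)) t) (at t)"
      using DERIV_mult[OF P E] 1 by (simp add: flat_exp_def power2_eq_square algebra_simps)
    then show ?thesis
      using 1 by (elim DERIV_cong_ev[THEN iffD1, rotated -1])
        (auto intro!: eventually_mono[OF eventually_gt_at_top] simp: flat_exp_def
          eventually_nhds intro: exI[of _ "{0<..}"])
  next
    case 2
    have "((\<lambda>t. 0) has_real_derivative flat_exp ([:0, 0, 1:] * (p - pderiv p)) t) (at t)"
      using 2 by (simp add: flat_exp_def)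
    then show ?thesis
      using 2 by (elim DERIV_cong_ev[THEN iffD1, rotated -1])
        (auto simp: flat_exp_def eventually_nhds intro: exI[of _ "{..<0}"])
  next
    case 3
    \<comment> \<open>Substituting \<open>y = 1/t\<close>, the difference quotient at 0 becomes \<open>y p(y) / exp y\<close>.\<close>
    have "((\<lambda>t. flat_exp p t / t) \<longlongrightarrow> 0) (at_right 0)"
    proof -
      have "((\<lambda>t. inverse t ^ 1 * poly p (inverse t) / exp (inverse t)) \<longlongrightarrow> 0) (at_right (0::real))"
        by (rule filterlim_compose[OF poly_over_exp_tendsto_0 filterlim_inverse_at_top_right])
      then show ?thesis
        by (rule Lim_transform_eventually)
          (auto simp: eventually_at_right_field flat_exp_def exp_minus inverse_eq_divide intro!: exI[of _ 1])
    qed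
    moreover have "((\<lambda>t. flat_exp p t / t) \<longlongrightarrow> 0) (at_left 0)"
      by (rule Lim_transform_eventually[OF tendsto_const])
        (auto simp: eventually_at_left_field flat_exp_def intro!: exI[of _ "-1"])
    ultimately have "((\<lambda>t. flat_exp p t / t) \<longlongrightarrow> 0) (at 0)"
      by (simp add: filterlim_split_at)
    then show ?thesis
      using 3 by (simp add: has_field_derivative_iff flat_exp_def)
  qed
qed

lemma smooth_on_flat_exp:
  assumes "open U" "smooth_on U u"
  shows "smooth_on U (\<lambda>x. flat_exp p (u x))"
proof -
  define g where "g k = flat_exp (((\<lambda>p. [:0, 0, 1:] * (p - pderiv p)) ^^ k) p)" for k
  have "(g k has_real_derivative g (Suc k) t) (at t)" for k t
    using flat_exp_has_derivative by (simp add: g_def)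
  from smooth_on_compose_real[where g = g and k = 0, OF assms this] show ?thesis
    by (simp add: g_def)
qed

lemma cutoff_exists:
  obtains \<eta> :: "real^2 \<Rightarrow> real" where "smooth_on UNIV \<eta>" "\<And>x. norm x \<le> 1 \<Longrightarrow> \<eta> x = 1"
    "\<And>x. 2 \<le> norm x \<Longrightarrow> \<eta> x = 0" "\<And>x. 0 \<le> \<eta> x"
proof -
  define q :: "real^2 \<Rightarrow> real" where "q x = x $ 1 * x $ 1 + x $ 2 * x $ 2" for x
  define a where "a x = flat_exp 1 (4 + (-1) * q x)" for x
  define b where "b x = flat_exp 1 (q x + (-1))" for x
  have qn: "q x = (norm x)\<^sup>2" for x
    by (simp add: q_def power2_norm_eq_inner inner_vec_def sum_2)
  have "smooth_on UNIV (\<lambda>x::real^2. x $ i)" for i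
    using smooth_on_bounded_linear[OF open_UNIV bounded_linear_vec_nth smooth_on_id] .
  then have sq: "smooth_on UNIV q"
    unfolding q_def by (intro smooth_on_add smooth_on_mult open_UNIV)
  have sa: "smooth_on UNIV a"
    unfolding a_def
    by (rule smooth_on_flat_exp[OF open_UNIV smooth_on_add[OF open_UNIV smooth_on_const
          smooth_on_cmult[OF open_UNIV sq]]])
  have sb: "smooth_on UNIV b"
    unfolding b_def
    by (rule smooth_on_flat_exp[OF open_UNIV smooth_on_add[OF open_UNIV sq smooth_on_const]])
  have nonneg: "0 \<le> a x" "0 \<le> b x" for x
    by (simp_all add: a_def b_def flat_exp_def)
  have pos: "a x + b x > 0" for x
  proof (cases "q x < 4")
    case True
    then have "a x > 0" by (simp add: a_def flat_exp_def)
    then show ?thesis using nonneg[of x] by linarith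
  next
    case False
    then have "b x > 0" by (simp add: b_def flat_exp_def)
    then show ?thesis using nonneg[of x] by linarith
  qed
  \<comment> \<open>\<open>a\<close> vanishes for \<open>norm x \<ge> 2\<close>, \<open>b\<close> for \<open>norm x \<le> 1\<close>, and nowhere both.\<close>
  show thesis
  proof
    show "smooth_on UNIV (\<lambda>x. a x * inverse (a x + b x))"
    proof (rule smooth_on_mult[OF open_UNIV sa smooth_on_inverse[OF open_UNIV smooth_on_add[OF open_UNIV sa sb]]])
      show "a x + b x \<noteq> 0" for x
        using pos[of x] by simp
    qed
    show "a x * inverse (a x + b x) = 1" if "norm x \<le> 1" for x
    proof -
      have "b x = 0"
        using power_le_one[OF norm_ge_zero that, of 2] by (simp add: b_def flat_exp_def qn)
      then show ?thesis using pos[of x] by simp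
    qed
    show "a x * inverse (a x + b x) = 0" if "2 \<le> norm x" for x
    proof -
      have "a x = 0"
        using power_mono[OF that, of 2] by (simp add: a_def flat_exp_def qn)
      then show ?thesis by simp
    qed
    show "0 \<le> a x * inverse (a x + b x)" for x
      using nonneg(1)[of x] pos[of x] by (intro mult_nonneg_nonneg) simp_all
  qed
qed

section \<open>Test functions\<close>

lemma test_funsI:
  assumes "smooth_on UNIV \<phi>" "compact K" "K \<subseteq> S" "\<And>x. x \<notin> K \<Longrightarrow> \<phi> x = 0"
  shows "\<phi> \<in> test_funs S UNIV"
proof -
  have "{x. \<phi> x \<noteq> 0} \<subseteq> K" using assms(4) by blast
  then have "closure {x. \<phi> x \<noteq> 0} \<subseteq> K"
    using assms(2) by (simp add: closure_minimal compact_imp_closed)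
  moreover from this have "compact (closure {x. \<phi> x \<noteq> 0})"
    using assms(2) by (metis closed_closure compact_Int_closed inf.absorb_iff2)
  ultimately show ?thesis
    using assms by (auto simp: test_funs_def)
qed

lemma test_funsE:
  assumes "\<phi> \<in> test_funs S V"
  obtains K where "smooth_on UNIV \<phi>" "compact K" "K \<subseteq> S" "\<And>x. x \<notin> K \<Longrightarrow> \<phi> x = 0"
proof -
  show thesis
  proof (rule that)
    show "smooth_on UNIV \<phi>" "compact (closure {x. \<phi> x \<noteq> 0})" "closure {x. \<phi> x \<noteq> 0} \<subseteq> S"
      using assms by (simp_all add: test_funs_def)
    show "\<phi> x = 0" if "x \<notin> closure {x. \<phi> x \<noteq> 0}" for x
      using that closure_subset[of "{x. \<phi> x \<noteq> 0}"] by blast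
  qed
qed

lemma test_funs_smooth: "\<phi> \<in> test_funs S V \<Longrightarrow> smooth_on UNIV \<phi>"
  by (simp add: test_funs_def)

lemma test_funs_mono: "\<phi> \<in> test_funs S UNIV \<Longrightarrow> S \<subseteq> S' \<Longrightarrow> \<phi> \<in> test_funs S' UNIV"
  by (auto simp: test_funs_def)

lemma test_funs_add:
  assumes "\<phi> \<in> test_funs S UNIV" "\<psi> \<in> test_funs S UNIV"
  shows "(\<lambda>x. \<phi> x + \<psi> x) \<in> test_funs S UNIV"
proof -
  obtain K where K: "smooth_on UNIV \<phi>" "compact K" "K \<subseteq> S" "\<And>x. x \<notin> K \<Longrightarrow> \<phi> x = 0"
    by (rule test_funsE[OF assms(1)]) (rule that)
  obtain L where L: "smooth_on UNIV \<psi>" "compact L" "L \<subseteq> S" "\<And>x. x \<notin> L \<Longrightarrow> \<psi> x = 0"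
    by (rule test_funsE[OF assms(2)]) (rule that)
  show ?thesis
    by (rule test_funsI[where K = "K \<union> L"]) (use K L in \<open>auto intro!: smooth_on_add\<close>)
qed

lemma test_funs_mult:
  fixes \<phi> :: "real^2 \<Rightarrow> real"
  assumes "\<phi> \<in> test_funs S UNIV" "smooth_on UNIV \<eta>"
  shows "(\<lambda>x. \<phi> x * \<eta> x) \<in> test_funs S UNIV"
proof -
  obtain K where K: "smooth_on UNIV \<phi>" "compact K" "K \<subseteq> S" "\<And>x. x \<notin> K \<Longrightarrow> \<phi> x = 0"
    by (rule test_funsE[OF assms(1)]) (rule that)
  show ?thesis
    by (rule test_funsI[OF smooth_on_mult[OF open_UNIV K(1) assms(2)] K(2,3)]) (simp add: K(4))
qed

lemma test_funs_cmult:
  fixes \<phi> :: "real^2 \<Rightarrow> real"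
  assumes "\<phi> \<in> test_funs S UNIV"
  shows "(\<lambda>x. c * \<phi> x) \<in> test_funs S UNIV"
  using test_funs_mult[OF assms smooth_on_const[of UNIV c]] by (simp add: mult.commute)

lemma test_funs_bounded_linear:
  assumes "\<phi> \<in> test_funs S V" "bounded_linear L" "range L \<subseteq> W"
  shows "(\<lambda>x. L (\<phi> x)) \<in> test_funs S W"
proof -
  obtain K where K: "smooth_on UNIV \<phi>" "compact K" "K \<subseteq> S" "\<And>x. x \<notin> K \<Longrightarrow> \<phi> x = 0"
    by (rule test_funsE[OF assms(1)]) (rule that)
  have "L 0 = 0" using assms(2) by (simp add: bounded_linear.linear linear_0)
  then have "(\<lambda>x. L (\<phi> x)) \<in> test_funs S UNIV"
    by (intro test_funsI[OF smooth_on_bounded_linear[OF open_UNIV assms(2) K(1)] K(2,3)]) (simp add: K(4))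
  then show ?thesis using assms(3) by (auto simp: test_funs_def)
qed

lemma pds_eq_0_outside:
  assumes "compact K" "\<And>x. x \<notin> K \<Longrightarrow> \<phi> x = 0" "x \<notin> K"
  shows "pds is \<phi> x = 0"
proof -
  have "pds is \<phi> x = pds is (\<lambda>x. 0) x"
    by (rule pds_cong[of "- K"]) (use assms in \<open>auto simp: compact_imp_closed\<close>)
  also have "pds is (\<lambda>x. 0) = (\<lambda>x. 0 :: 'a)"
    by (induction "is") (simp_all add: pds_Cons)
  finally show ?thesis .
qed

lemma test_funs_pds:
  assumes "\<phi> \<in> test_funs S UNIV"
  shows "pds is \<phi> \<in> test_funs S UNIV"
proof -
  obtain K where K: "smooth_on UNIV \<phi>" "compact K" "K \<subseteq> S" "\<And>x. x \<notin> K \<Longrightarrow> \<phi> x = 0"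
    by (rule test_funsE[OF assms(1)]) (rule that)
  show ?thesis
    by (rule test_funsI[OF smooth_on_pds[OF K(1)] K(2,3) pds_eq_0_outside[OF K(2,4)]])
qed

lemma test_funs_pd: "\<phi> \<in> test_funs S UNIV \<Longrightarrow> pd i \<phi> \<in> test_funs S UNIV"
  using test_funs_pds[of \<phi> S "[i]"] by (simp add: pds_Cons)

lemma bounded_of_compact_support:
  assumes "compact K" "continuous_on K f" "\<And>x. x \<notin> K \<Longrightarrow> f x = 0"
  obtains M where "\<And>x. norm (f x) \<le> M" "0 \<le> M"
proof -
  have "bounded (f ` K)"
    using assms by (simp add: compact_continuous_image compact_imp_bounded)
  then obtain M where "\<And>x. x \<in> K \<Longrightarrow> norm (f x) \<le> M"
    by (auto simp: bounded_iff)
  then have "norm (f x) \<le> max M 0" for x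
    using assms(3)[of x] by (cases "x \<in> K") (auto simp: le_max_iff_disj)
  then show thesis using that by (metis max.cobounded2)
qed

lemma test_funs_affine:
  assumes "smooth_on UNIV \<eta>" "\<And>x. R \<le> norm x \<Longrightarrow> \<eta> x = 0" "l > 0" "cball a (R * l) \<subseteq> S"
  shows "(\<lambda>x. \<eta> (inverse l *\<^sub>R (x - a))) \<in> test_funs S UNIV"
proof (rule test_funsI[OF smooth_on_affine[OF assms(1)] compact_cball assms(4)])
  fix x assume "x \<notin> cball a (R * l)"
  then have "R * l \<le> norm (x - a)" by (simp add: dist_norm norm_minus_commute)
  then have "R \<le> norm (inverse l *\<^sub>R (x - a))"
    unfolding norm_scaleR using assms(3) by (simp add: field_simps)
  then show "\<eta> (inverse l *\<^sub>R (x - a)) = 0" by (rule assms(2))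
qed

lemma test_funs_bounded:
  assumes "\<phi> \<in> test_funs S UNIV"
  shows "\<exists>M. \<forall>x. norm (\<phi> x) \<le> M"
proof -
  obtain K where K: "smooth_on UNIV \<phi>" "compact K" "\<And>x. x \<notin> K \<Longrightarrow> \<phi> x = 0"
    by (rule test_funsE[OF assms]) (rule that)
  have "continuous_on K \<phi>"
    using smooth_on_imp_continuous_on[OF K(1)] continuous_on_subset by blast
  from bounded_of_compact_support[OF K(2) this K(3)] show ?thesis by blast
qed

lemma test_funs_dilate:
  assumes \<phi>: "\<phi> \<in> test_funs S UNIV" and l: "l > 0" and S: "(\<lambda>x. l *\<^sub>R x) ` S \<subseteq> S'"
  shows "(\<lambda>x. \<phi> (inverse l *\<^sub>R x)) \<in> test_funs S' UNIV"
proof -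
  obtain K where K: "smooth_on UNIV \<phi>" "compact K" "K \<subseteq> S" "\<And>x. x \<notin> K \<Longrightarrow> \<phi> x = 0"
    by (rule test_funsE[OF \<phi>]) (rule that)
  show ?thesis
  proof (rule test_funsI)
    show "smooth_on UNIV (\<lambda>x. \<phi> (inverse l *\<^sub>R x))"
      using smooth_on_affine[OF K(1), of "inverse l" 0] by simp
    show "compact ((\<lambda>x. l *\<^sub>R x) ` K)" using K(2) by (rule compact_scaling)
    show "(\<lambda>x. l *\<^sub>R x) ` K \<subseteq> S'" using K(3) S by blast
    show "\<phi> (inverse l *\<^sub>R x) = 0" if "x \<notin> (\<lambda>x. l *\<^sub>R x) ` K" for x
    proof (rule K(4))
      show "inverse l *\<^sub>R x \<notin> K"
        using that l by (auto simp: image_iff dest: bspec[of _ _ "inverse l *\<^sub>R x"])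
    qed
  qed
qed

text \<open>A partition of unity argument in inductive form: if \<open>\<phi>\<close> vanishes outside the balls
  \<open>B\<^sub>1, \<dots>, B\<^sub>n\<close> and \<open>\<eta>\<close> is a cutoff function equal to 1 on \<open>B\<^sub>1\<close>, then \<open>\<phi> \<eta>\<close> is localised near
  \<open>B\<^sub>1\<close>, while \<open>\<phi> (1 - \<eta>)\<close> vanishes outside \<open>B\<^sub>2, \<dots>, B\<^sub>n\<close>.\<close>

lemma test_funs_localise:
  fixes Q :: "(real^2 \<Rightarrow> real) \<Rightarrow> bool"
  assumes loc: "\<And>x. x \<in> U \<Longrightarrow> \<exists>V. open V \<and> x \<in> V \<and> (\<forall>\<phi>\<in>test_funs V UNIV. \<phi> \<in> test_funs U UNIV \<longrightarrow> Q \<phi>)"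
    and add: "\<And>\<phi> \<psi>. \<phi> \<in> test_funs U UNIV \<Longrightarrow> \<psi> \<in> test_funs U UNIV \<Longrightarrow> Q \<phi> \<Longrightarrow> Q \<psi> \<Longrightarrow> Q (\<lambda>x. \<phi> x + \<psi> x)"
    and zero: "Q (\<lambda>x. 0)"
    and \<phi>: "\<phi> \<in> test_funs U UNIV"
  shows "Q \<phi>"
proof -
  obtain \<eta> :: "real^2 \<Rightarrow> real" where \<eta>: "smooth_on UNIV \<eta>" "\<And>x. norm x \<le> 1 \<Longrightarrow> \<eta> x = 1"
    "\<And>x. 2 \<le> norm x \<Longrightarrow> \<eta> x = 0" "\<And>x. 0 \<le> \<eta> x"
    using cutoff_exists by blast
  have "\<exists>\<rho>>0. \<forall>\<phi>\<in>test_funs (cball x (2 * \<rho>)) UNIV. \<phi> \<in> test_funs U UNIV \<longrightarrow> Q \<phi>" if x: "x \<in> U" for x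
  proof -
    obtain V where V: "open V" "x \<in> V" "\<And>\<phi>. \<phi> \<in> test_funs V UNIV \<Longrightarrow> \<phi> \<in> test_funs U UNIV \<Longrightarrow> Q \<phi>"
      using loc[OF x] by blast
    obtain e where "e > 0" "cball x e \<subseteq> V"
      using V(1,2) open_contains_cball by blast
    then show ?thesis
      using V(3)[OF test_funs_mono[of _ "cball x e" V]] by (intro exI[of _ "e / 2"]) auto
  qed
  then obtain \<rho> where \<rho>: "\<And>x. x \<in> U \<Longrightarrow> \<rho> x > 0"
    "\<And>x \<phi>. x \<in> U \<Longrightarrow> \<phi> \<in> test_funs (cball x (2 * \<rho> x)) UNIV \<Longrightarrow> \<phi> \<in> test_funs U UNIV \<Longrightarrow> Q \<phi>"
    by metis
  obtain K where K: "compact K" "K \<subseteq> U" "\<And>x. x \<notin> K \<Longrightarrow> \<phi> x = 0"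
    by (rule test_funsE[OF \<phi>]) (rule that)
  have "K \<subseteq> (\<Union>x\<in>U. ball x (\<rho> x))"
    using K(2) \<rho>(1) by force
  then obtain F where F: "F \<subseteq> U" "finite F" "K \<subseteq> (\<Union>x\<in>F. ball x (\<rho> x))"
    using compactE_image[OF K(1), of U "\<lambda>x. ball x (\<rho> x)"] by auto
  have "Q \<phi>" if "finite F" "F \<subseteq> U" "\<phi> \<in> test_funs U UNIV"
    "\<And>x. x \<notin> (\<Union>x\<in>F. ball x (\<rho> x)) \<Longrightarrow> \<phi> x = 0" for F \<phi>
    using that
  proof (induction F arbitrary: \<phi>)
    case empty
    then have "\<phi> = (\<lambda>x. 0)" by auto
    then show ?case using zero by simp
  next
    case (insert a F)
    have a: "\<rho> a > 0" using insert.prems \<rho>(1) by simp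
    define \<theta> where "\<theta> x = \<eta> (inverse (\<rho> a) *\<^sub>R (x - a))" for x
    have \<theta>: "smooth_on UNIV \<theta>" "\<theta> \<in> test_funs (cball a (2 * \<rho> a)) UNIV"
      unfolding \<theta>_def using smooth_on_affine[OF \<eta>(1)] test_funs_affine[OF \<eta>(1,3) a] by auto
    have \<theta>': "smooth_on UNIV (\<lambda>x. 1 + (-1) * \<theta> x)"
      by (intro smooth_on_add smooth_on_const smooth_on_cmult \<theta> open_UNIV)
    have 1: "(\<lambda>x. \<phi> x * \<theta> x) \<in> test_funs U UNIV"
      and 2: "(\<lambda>x. \<phi> x * (1 + (-1) * \<theta> x)) \<in> test_funs U UNIV"
      using test_funs_mult[OF insert.prems(2)] \<theta> \<theta>' by auto
    have "(\<lambda>x. \<theta> x * \<phi> x) \<in> test_funs (cball a (2 * \<rho> a)) UNIV"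
      using test_funs_mult[OF \<theta>(2) test_funs_smooth[OF insert.prems(2)]] .
    then have "Q (\<lambda>x. \<phi> x * \<theta> x)"
      using \<rho>(2)[of a "\<lambda>x. \<phi> x * \<theta> x"] insert.prems 1 by (simp add: mult.commute)
    moreover have "Q (\<lambda>x. \<phi> x * (1 + (-1) * \<theta> x))"
    proof (rule insert.IH[OF _ 2])
      show "F \<subseteq> U" using insert.prems by simp
      fix x assume x: "x \<notin> (\<Union>x\<in>F. ball x (\<rho> x))"
      show "\<phi> x * (1 + (-1) * \<theta> x) = 0"
      proof (cases "x \<in> ball a (\<rho> a)")
        case True
        then have "norm (inverse (\<rho> a) *\<^sub>R (x - a)) \<le> 1"
          unfolding norm_scaleR using a by (simp add: field_simps dist_norm norm_minus_commute)
        then show ?thesis by (simp add: \<theta>_def \<eta>(2))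
      next
        case False
        then show ?thesis using insert.prems(3)[of x] x by simp
      qed
    qed
    ultimately have "Q (\<lambda>x. \<phi> x * \<theta> x + \<phi> x * (1 + (-1) * \<theta> x))"
      by (rule add[OF 1 2])
    then show ?case by (simp add: algebra_simps)
  qed
  from this[OF F(2,1) \<phi>] F(3) K(3) show ?thesis by blast
qed

section \<open>Integration of functions with compact support\<close>

lemma integrable_of_compact_support:
  fixes f :: "real^2 \<Rightarrow> 'b::euclidean_space"
  assumes "compact K" "continuous_on K f" "\<And>x. x \<notin> K \<Longrightarrow> f x = 0"
  shows "integrable lborel f"
proof -
  have "integrable lborel (\<lambda>x. indicator K x *\<^sub>R f x)"
    using borel_integrable_compact[OF assms(1,2)] .
  also have "(\<lambda>x. indicator K x *\<^sub>R f x) = f"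
    using assms(3) by (auto simp: indicator_def)
  finally show ?thesis .
qed

text \<open>The integral of a partial derivative is the limit of integrals of difference quotients, and
  each of these vanishes because the Lebesgue measure is translation invariant. The bound on the
  derivative dominates the difference quotients on a slightly larger ball.\<close>

lemma integral_pd_eq_0:
  fixes g :: "real^2 \<Rightarrow> real"
  assumes K: "compact K" "\<And>x. x \<notin> K \<Longrightarrow> g x = 0"
    and diff: "\<And>x. g differentiable (at x)" and cont: "\<And>i. continuous_on K (pd i g)"
  shows "(LINT x|lborel. pd j g x) = 0"
proof -
  have K': "compact K" "\<And>x. x \<notin> K \<Longrightarrow> pd i g x = 0" for i
    using pds_eq_0_outside[OF K, of _ _ "[i]"] K(1) by (auto simp: pds_Cons)
  have "\<exists>M. \<forall>x. \<bar>pd i g x\<bar> \<le> M" for i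
    using bounded_of_compact_support[OF K(1) cont K'(2), of i] by (metis real_norm_def)
  then obtain M where M: "\<And>i x. \<bar>pd i g x\<bar> \<le> M i" by metis
  have D: "(g has_derivative frechet_derivative g (at x)) (at x)" for x
    using diff frechet_derivative_works by blast
  have contg: "continuous_on UNIV g"
    using diff by (meson continuous_at_imp_continuous_on differentiable_imp_continuous_within)
  let ?e = "axis j 1 :: real^2"
  define q where "q n x = (g (x + inverse (real (Suc n)) *\<^sub>R ?e) - g x) * real (Suc n)" for n x
  obtain R where R: "\<And>x. x \<in> K \<Longrightarrow> norm x \<le> R"
    using K(1) by (meson bounded_iff compact_imp_bounded)
  define C where "C = cball (0::real^2) (R + 1)"
  have int: "integrable lborel g"
    by (rule integrable_of_compact_support[OF K(1) _ K(2)]) (use contg continuous_on_subset in blast)+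
  have shift: "integrable lborel (\<lambda>x. g (x + c))" "(LINT x|lborel. g (x + c)) = (LINT x|lborel. g x)" for c
  proof -
    have c: "(+) c \<in> measurable lborel borel" by simp
    have "integrable (distr lborel borel ((+) c)) g"
      using int by (simp add: lborel_distr_plus)
    from integrable_distr[OF c this] show "integrable lborel (\<lambda>x. g (x + c))"
      by (simp add: add.commute)
    have "integral\<^sup>L (distr lborel borel ((+) c)) g = (LINT x|lborel. g (c + x))"
      by (rule integral_distr[OF c borel_measurable_continuous_onI[OF contg]])
    then show "(LINT x|lborel. g (x + c)) = (LINT x|lborel. g x)"
      by (simp add: lborel_distr_plus add.commute)
  qed
  have "(LINT x|lborel. q n x) = 0" for n
    unfolding q_def by (simp add: shift int)
  moreover have "(\<lambda>n. LINT x|lborel. q n x) \<longlonglongrightarrow> (LINT x|lborel. pd j g x)"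
  proof (rule integral_dominated_convergence[where w = "\<lambda>x. indicator C x *\<^sub>R M j"])
    have lim: "(\<lambda>n. q n x) \<longlonglongrightarrow> pd j g x" for x
    proof -
      have "((\<lambda>t. g (x + t *\<^sub>R ?e)) has_derivative (\<lambda>t. frechet_derivative g (at x) (t *\<^sub>R ?e))) (at 0)"
        by (rule has_derivative_compose[of "\<lambda>t. x + t *\<^sub>R ?e" "\<lambda>t. t *\<^sub>R ?e"])
          (auto intro!: derivative_eq_intros D)
      then have "((\<lambda>t. g (x + t *\<^sub>R ?e)) has_real_derivative pd j g x) (at 0)"
        by (simp add: has_field_derivative_def pd_def linear_cmul[OF has_derivative_linear[OF D]]
            mult.commute[of _ "frechet_derivative g (at x) (axis j 1)"] fun_eq_iff)
      then have "((\<lambda>t. (g (x + t *\<^sub>R ?e) - g x) / t) \<longlongrightarrow> pd j g x) (at 0)"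
        by (simp add: has_field_derivative_iff)
      moreover have "filterlim (\<lambda>n. inverse (real (Suc n))) (at 0) sequentially"
        by (auto simp: filterlim_at LIMSEQ_inverse_real_of_nat simp del: of_nat_Suc)
      ultimately have "(\<lambda>n. (g (x + inverse (real (Suc n)) *\<^sub>R ?e) - g x) / inverse (real (Suc n))) \<longlonglongrightarrow> pd j g x"
        by (rule filterlim_compose)
      then show ?thesis by (simp add: q_def divide_inverse del: of_nat_Suc)
    qed
    show "AE x in lborel. (\<lambda>n. q n x) \<longlonglongrightarrow> pd j g x"
      using lim by simp
    show meas: "q n \<in> borel_measurable lborel" for n
      unfolding q_def by (intro borel_measurable_times borel_measurable_diff borel_measurable_const
          borel_measurable_integrable shift(1) int)
    show "pd j g \<in> borel_measurable lborel"
      using borel_measurable_LIMSEQ_real[OF lim meas] by simp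
    show "integrable lborel (\<lambda>x. indicator C x *\<^sub>R M j)"
      by (rule borel_integrable_compact) (auto simp: C_def)
    show "AE x in lborel. norm (q n x) \<le> indicator C x *\<^sub>R M j" for n
    proof (rule AE_I2)
      fix x
      let ?h = "inverse (real (Suc n))"
      have h: "0 < ?h" "?h \<le> 1" by (auto simp: inverse_le_1_iff)
      show "norm (q n x) \<le> indicator C x *\<^sub>R M j"
      proof (cases "x \<in> C")
        case True
        have "norm (g (x + ?h *\<^sub>R ?e) - g (x + 0 *\<^sub>R ?e)) \<le> M j * norm (?h - 0)"
        proof (rule differentiable_bound[where f = "\<lambda>t. g (x + t *\<^sub>R ?e)" and S = UNIV
              and f' = "\<lambda>t s. s * pd j g (x + t *\<^sub>R ?e)"])
          fix t :: real
          have "((\<lambda>t. g (x + t *\<^sub>R ?e)) has_derivative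
              (\<lambda>s. frechet_derivative g (at (x + t *\<^sub>R ?e)) (s *\<^sub>R ?e))) (at t)"
            by (rule has_derivative_compose[of "\<lambda>t. x + t *\<^sub>R ?e" "\<lambda>t. t *\<^sub>R ?e"])
              (auto intro!: derivative_eq_intros D)
          then show "((\<lambda>t. g (x + t *\<^sub>R ?e)) has_derivative (\<lambda>s. s * pd j g (x + t *\<^sub>R ?e))) (at t)"
            by (simp add: pd_def linear_cmul[OF has_derivative_linear[OF D]])
          show "onorm (\<lambda>s. s * pd j g (x + t *\<^sub>R ?e)) \<le> M j"
            by (rule onorm_le) (metis M abs_ge_zero abs_mult mult.commute mult_left_mono real_norm_def)
        qed auto
        then show ?thesis
          using True h unfolding q_def real_norm_def abs_mult
          by (simp add: divide_inverse[symmetric] pos_le_divide_eq inverse_eq_divide del: of_nat_Suc)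
      next
        case False
        then have x: "norm x > R + 1" by (simp add: C_def)
        have "norm x \<le> norm (x + ?h *\<^sub>R ?e) + norm (?h *\<^sub>R ?e)"
          by (metis add_diff_cancel_right' norm_triangle_ineq4)
        then have "norm (x + ?h *\<^sub>R ?e) > R"
          using x h by (simp del: of_nat_Suc)
        then have "g x = 0" "g (x + ?h *\<^sub>R ?e) = 0"
          using x R K(2) by fastforce+
        then show ?thesis using False by (simp add: q_def)
      qed
    qed
  qed
  ultimately show ?thesis
    using LIMSEQ_unique[OF tendsto_const] by fastforce
qed

subsection \<open>Integration by parts and the fundamental lemma\<close>

lemma integrable_test_fun_scaleR:
  fixes f :: "real^2 \<Rightarrow> 'b::euclidean_space"
  assumes "\<phi> \<in> test_funs U UNIV" "continuous_on U f"
  shows "integrable lborel (\<lambda>x. \<phi> x *\<^sub>R f x)"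
proof -
  obtain K where K: "smooth_on UNIV \<phi>" "compact K" "K \<subseteq> U" "\<And>x. x \<notin> K \<Longrightarrow> \<phi> x = 0"
    by (rule test_funsE[OF assms(1)]) (rule that)
  have "continuous_on K (\<lambda>x. \<phi> x *\<^sub>R f x)"
    using K(3) assms(2) smooth_on_imp_continuous_on[OF K(1)]
    by (intro continuous_on_scaleR) (auto intro: continuous_on_subset)
  then show ?thesis
    by (rule integrable_of_compact_support[OF K(2)]) (simp add: K(4))
qed

lemma integrable_test_fun_mult:
  fixes f :: "real^2 \<Rightarrow> real"
  shows "\<phi> \<in> test_funs U UNIV \<Longrightarrow> continuous_on U f \<Longrightarrow> integrable lborel (\<lambda>x. \<phi> x * f x)"
  using integrable_test_fun_scaleR[of \<phi> U f] by simp

text \<open>Since \<open>f\<close> is smooth on \<open>U\<close> only, the product \<open>\<phi> f\<close> has to be seen to be differentiable in the whole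
  plane: near a point outside \<open>U\<close> it vanishes, because the support of \<open>\<phi>\<close> is a closed subset of \<open>U\<close>.\<close>

lemma integration_by_parts:
  fixes f :: "real^2 \<Rightarrow> real"
  assumes U: "open U" and \<phi>: "\<phi> \<in> test_funs U UNIV" and f: "smooth_on U f"
  shows "(LINT x|lborel. pd j \<phi> x * f x) = - (LINT x|lborel. \<phi> x * pd j f x)"
proof -
  obtain K where K: "smooth_on UNIV \<phi>" "compact K" "K \<subseteq> U" "\<And>x. x \<notin> K \<Longrightarrow> \<phi> x = 0"
    by (rule test_funsE[OF \<phi>]) (rule that)
  define g where "g x = \<phi> x * f x" for x
  have \<phi>': "\<phi> differentiable (at x)" for x
    using smooth_on_imp_differentiable[OF K(1)] by simp
  have pdK: "pd i \<phi> x = 0" "pd i g x = 0" if "x \<notin> K" for i x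
  proof -
    have "pds [i] \<phi> x = 0" "pds [i] g x = 0"
      using K(4) by (auto intro!: pds_eq_0_outside[OF K(2) _ that] simp: g_def)
    then show "pd i \<phi> x = 0" "pd i g x = 0" by (simp_all add: pds_Cons)
  qed
  have pdg: "pd i g x = pd i \<phi> x * f x + \<phi> x * pd i f x" for i x
  proof (cases "x \<in> U")
    case True
    then show ?thesis
      unfolding g_def by (intro pd_mult \<phi>' smooth_on_imp_differentiable[OF f])
  next
    case False
    then have "x \<notin> K" using K(3) by blast
    then show ?thesis by (simp add: pdK K(4))
  qed
  have "(LINT x|lborel. pd j g x) = 0"
  proof (rule integral_pd_eq_0[OF K(2)])
    show "g x = 0" if "x \<notin> K" for x
      using K(4)[OF that] by (simp add: g_def)
    show "g differentiable (at x)" for x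
    proof (cases "x \<in> U")
      case True
      then show ?thesis
        unfolding g_def by (intro differentiable_mult \<phi>' smooth_on_imp_differentiable[OF f])
    next
      case False
      have "g differentiable (at x) \<longleftrightarrow> (\<lambda>x. 0::real) differentiable (at x)"
        by (rule differentiable_cong[of "- K"]) (use K(2,3,4) False in \<open>auto simp: g_def compact_imp_closed\<close>)
      then show ?thesis by simp
    qed
    show "continuous_on K (pd i g)" for i
    proof -
      have "continuous_on K f" "continuous_on K (pd i f)"
        using f smooth_on_pd[OF f] K(3) smooth_on_imp_continuous_on continuous_on_subset by blast+
      moreover have "continuous_on K \<phi>" "continuous_on K (pd i \<phi>)"
        using K(1) smooth_on_pd[OF K(1)] smooth_on_imp_continuous_on continuous_on_subset by blast+
      ultimately show ?thesis
        unfolding pdg[abs_def] by (intro continuous_intros)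
    qed
  qed
  moreover have "integrable lborel (\<lambda>x. pd j \<phi> x * f x)" "integrable lborel (\<lambda>x. \<phi> x * pd j f x)"
    by (intro integrable_test_fun_mult[of _ U] \<phi> test_funs_pd smooth_on_imp_continuous_on f smooth_on_pd)+
  ultimately show ?thesis
    by (simp add: pdg)
qed

text \<open>The fundamental lemma of the calculus of variations. If \<open>u a \<noteq> 0\<close>, then \<open>v = u a * u\<close> is positive
  near \<open>a\<close>, and testing with a nonnegative cutoff function concentrated there gives a positive
  integral.\<close>

lemma eq_0_of_integral_test_funs_eq_0:
  fixes u :: "real^2 \<Rightarrow> real"
  assumes U: "open U" and u: "continuous_on U u"
    and zero: "\<And>\<phi>. \<phi> \<in> test_funs U UNIV \<Longrightarrow> (LINT x|lborel. \<phi> x * u x) = 0"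
    and a: "a \<in> U"
  shows "u a = 0"
proof (rule ccontr)
  assume "u a \<noteq> 0"
  define v where "v x = u a * u x" for x
  have va: "v a > 0" using \<open>u a \<noteq> 0\<close> by (simp add: v_def zero_less_mult_iff linorder_neq_iff disj_commute)
  have v: "continuous_on U v"
    unfolding v_def by (intro continuous_intros u)
  obtain \<eta> :: "real^2 \<Rightarrow> real" where \<eta>: "smooth_on UNIV \<eta>" "\<And>x. norm x \<le> 1 \<Longrightarrow> \<eta> x = 1"
    "\<And>x. 2 \<le> norm x \<Longrightarrow> \<eta> x = 0" "\<And>x. 0 \<le> \<eta> x"
    using cutoff_exists by blast
  have "isCont v a"
    using v U a by (simp add: continuous_on_eq_continuous_at)
  then obtain d where d: "d > 0" "\<And>x. dist x a < d \<Longrightarrow> dist (v x) (v a) < v a / 2"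
    using half_gt_zero[OF va] unfolding continuous_at_eps_delta by blast
  obtain e where e: "e > 0" "cball a e \<subseteq> U"
    using U a open_contains_cball by blast
  define \<rho> where "\<rho> = min (d / 3) (e / 2)"
  have \<rho>: "\<rho> > 0" "2 * \<rho> < d" "2 * \<rho> \<le> e"
    using d(1) e(1) by (auto simp: \<rho>_def)
  define \<phi> where "\<phi> x = \<eta> (inverse \<rho> *\<^sub>R (x - a))" for x
  have "cball a (2 * \<rho>) \<subseteq> U" using e(2) \<rho>(3) by auto
  then have \<phi>: "\<phi> \<in> test_funs U UNIV"
    unfolding \<phi>_def by (intro test_funs_affine[where R = 2] \<eta> \<rho>(1))
  have out: "\<phi> x = 0" if "2 * \<rho> \<le> dist x a" for x
    unfolding \<phi>_def
    by (rule \<eta>(3), unfold norm_scaleR) (use that \<rho>(1) in \<open>simp add: dist_norm field_simps\<close>)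
  have in1: "\<phi> x = 1" if "dist x a < \<rho>" for x
    unfolding \<phi>_def
    by (rule \<eta>(2), unfold norm_scaleR) (use that \<rho>(1) in \<open>simp add: dist_norm field_simps\<close>)
  have pos: "v x > v a / 2" if "dist x a < 2 * \<rho>" for x
    using d(2)[of x] that \<rho>(2) by (simp add: dist_real_def abs_if split: if_splits)
  have "v a / 2 * measure lborel (ball a \<rho>) = (LINT x|lborel. indicator (ball a \<rho>) x *\<^sub>R (v a / 2))"
    by simp
  also have "\<dots> \<le> (LINT x|lborel. \<phi> x * v x)"
  proof (rule integral_mono)
    show "integrable lborel (\<lambda>x. indicator (ball a \<rho>) x *\<^sub>R (v a / 2))"
      by (intro integrable_scaleR_left integrable_real_indicator) (use emeasure_lborel_ball_finite[of a \<rho>] in auto)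
    show "integrable lborel (\<lambda>x. \<phi> x * v x)"
      by (rule integrable_test_fun_mult[OF \<phi> v])
    fix x :: "real^2"
    consider "dist x a < \<rho>" | "\<rho> \<le> dist x a" "dist x a < 2 * \<rho>" | "2 * \<rho> \<le> dist x a" by linarith
    then show "indicator (ball a \<rho>) x *\<^sub>R (v a / 2) \<le> \<phi> x * v x"
    proof cases
      case 1
      then show ?thesis using in1 pos[of x] \<rho>(1) by (simp add: dist_commute)
    next
      case 2
      have "0 \<le> \<phi> x" by (simp add: \<phi>_def \<eta>(4))
      moreover have "0 \<le> v x" using pos[of x] 2 va by simp
      ultimately show ?thesis using 2 by (simp add: dist_commute)
    next
      case 3
      then show ?thesis using out \<rho>(1) by (simp add: dist_commute)
    qed
  qed
  also have "\<dots> = (LINT x|lborel. u a * (\<phi> x * u x))"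
    by (simp add: v_def mult.left_commute)
  also have "\<dots> = u a * (LINT x|lborel. \<phi> x * u x)"
    by simp
  also have "\<dots> = 0" by (simp add: zero[OF \<phi>])
  finally show False
    using va content_ball_pos[OF \<rho>(1), of a] by (simp add: mult_le_0_iff)
qed

section \<open>Distributions and their regular part\<close>

lemma distributions_add:
  assumes "T \<in> distributions \<Omega> V" "\<phi> \<in> test_funs \<Omega> UNIV" "\<psi> \<in> test_funs \<Omega> UNIV"
  shows "T (\<lambda>x. \<phi> x + \<psi> x) = T \<phi> + T \<psi>"
  using assms by (simp add: distributions_def)

lemma distributions_cmult:
  assumes "T \<in> distributions \<Omega> V" "\<phi> \<in> test_funs \<Omega> UNIV"
  shows "T (\<lambda>x. c * \<phi> x) = c *\<^sub>R T \<phi>"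
  using assms by (simp add: distributions_def)

lemma distributions_zero:
  assumes "T \<in> distributions \<Omega> V"
  shows "T (\<lambda>x. 0) = 0"
proof -
  have "(\<lambda>x. 0) \<in> test_funs \<Omega> (UNIV :: real set)"
    by (rule test_funsI[of _ "{}"]) (simp_all add: smooth_on_const)
  from distributions_cmult[OF assms this, of 0] show ?thesis by simp
qed

text \<open>The sum of suprema in the seminorm estimate is at most \<open>M\<close> times the number of derivatives of
  order up to \<open>N\<close>.\<close>

lemma distributions_bound:
  assumes T: "T \<in> distributions \<Omega> V" and K: "compact K" "K \<subseteq> \<Omega>"
  shows "\<exists>C\<ge>0. \<exists>N. \<forall>\<phi>\<in>test_funs K UNIV. \<forall>M.
    (\<forall>is x. length is \<le> N \<longrightarrow> \<bar>pds is \<phi> x\<bar> \<le> M) \<longrightarrow> norm (T \<phi>) \<le> C * M"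
proof -
  have "\<exists>C N. \<forall>\<phi>\<in>test_funs K UNIV.
      norm (T \<phi>) \<le> C * (\<Sum>is\<in>{is. length is \<le> N}. SUP x. \<bar>pds is \<phi> x\<bar>)"
    using T K by (simp add: distributions_def)
  then obtain C N where CN: "\<And>\<phi>. \<phi> \<in> test_funs K UNIV \<Longrightarrow>
      norm (T \<phi>) \<le> C * (\<Sum>is\<in>{is. length is \<le> N}. SUP x. \<bar>pds is \<phi> x\<bar>)"
    by blast
  let ?I = "{is::2 list. length is \<le> N}"
  have "norm (T \<phi>) \<le> (\<bar>C\<bar> * card ?I) * M"
    if \<phi>: "\<phi> \<in> test_funs K UNIV" and M: "\<And>is x. length is \<le> N \<Longrightarrow> \<bar>pds is \<phi> x\<bar> \<le> M" for \<phi> M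
  proof -
    have sup: "\<bar>SUP x. \<bar>pds is \<phi> x\<bar>\<bar> \<le> M" if "is \<in> ?I" for "is"
    proof -
      have le: "\<bar>pds is \<phi> x\<bar> \<le> M" for x using M that by simp
      have "\<bar>pds is \<phi> 0\<bar> \<le> (SUP x. \<bar>pds is \<phi> x\<bar>)"
        using le by (intro cSUP_upper) (auto intro!: bdd_aboveI[of _ M])
      moreover have "(SUP x. \<bar>pds is \<phi> x\<bar>) \<le> M"
        using le by (intro cSUP_least) auto
      ultimately show ?thesis by simp
    qed
    have "norm (T \<phi>) \<le> \<bar>C * (\<Sum>is\<in>?I. SUP x. \<bar>pds is \<phi> x\<bar>)\<bar>"
      using CN[OF \<phi>] by linarith
    also have "\<dots> \<le> \<bar>C\<bar> * (\<Sum>is\<in>?I. \<bar>SUP x. \<bar>pds is \<phi> x\<bar>\<bar>)"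
      unfolding abs_mult by (intro mult_left_mono sum_abs) simp
    also have "\<dots> \<le> \<bar>C\<bar> * (\<Sum>is\<in>?I. M)"
      by (intro mult_left_mono sum_mono sup) auto
    finally show ?thesis by (simp add: mult.assoc)
  qed
  moreover have "0 \<le> \<bar>C\<bar> * card ?I" by simp
  ultimately show ?thesis by blast
qed

lemma integral_test_fun_bounded_linear:
  fixes f :: "real^2 \<Rightarrow> 'b::euclidean_space" and L :: "'b \<Rightarrow> 'c::euclidean_space"
  assumes "bounded_linear L" "\<phi> \<in> test_funs U UNIV" "continuous_on U f"
  shows "L (LINT x|lborel. \<phi> x *\<^sub>R f x) = (LINT x|lborel. \<phi> x *\<^sub>R L (f x))"
  using integral_bounded_linear[OF assms(1) integrable_test_fun_scaleR[OF assms(2,3)]]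
  by (simp add: linear_cmul[OF bounded_linear.linear[OF assms(1)]])

text \<open>Each component of \<open>f - g\<close> is annihilated by all test functions on \<open>U \<inter> V\<close>.\<close>

lemma represents_on_unique:
  assumes U: "open U" "represents_on U f T" and V: "open V" "represents_on V g T" and a: "a \<in> U" "a \<in> V"
  shows "f a = g a"
proof -
  have f: "continuous_on (U \<inter> V) f" and g: "continuous_on (U \<inter> V) g"
    using U(2) V(2) smooth_on_imp_continuous_on continuous_on_subset
    unfolding represents_on_def by blast+
  have "(f a - g a) \<bullet> b = 0" if "b \<in> Basis" for b
  proof (rule eq_0_of_integral_test_funs_eq_0[where U = "U \<inter> V" and u = "\<lambda>x. (f x - g x) \<bullet> b"])
    show "open (U \<inter> V)" "a \<in> U \<inter> V" using U V a by auto
    show fg: "continuous_on (U \<inter> V) (\<lambda>x. (f x - g x) \<bullet> b)"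
      using f g by (intro continuous_intros)
    fix \<phi> :: "real^2 \<Rightarrow> real" assume \<phi>: "\<phi> \<in> test_funs (U \<inter> V) UNIV"
    have "(LINT x|lborel. \<phi> x *\<^sub>R f x) = T \<phi>"
      using U(2) test_funs_mono[OF \<phi>, of U] by (simp add: represents_on_def)
    moreover have "(LINT x|lborel. \<phi> x *\<^sub>R g x) = T \<phi>"
      using V(2) test_funs_mono[OF \<phi>, of V] by (simp add: represents_on_def)
    ultimately have "(LINT x|lborel. \<phi> x *\<^sub>R (f x - g x)) = 0"
      by (simp add: scaleR_right_diff_distrib integrable_test_fun_scaleR[OF \<phi> f]
          integrable_test_fun_scaleR[OF \<phi> g])
    then show "(LINT x|lborel. \<phi> x * ((f x - g x) \<bullet> b)) = 0"
      using integral_test_fun_bounded_linear[OF bounded_linear_inner_left \<phi> continuous_on_diff[OF f g], of b]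
      by simp
  qed
  then show ?thesis
    by (simp add: euclidean_eq_iff[of "f a"] inner_diff_left)
qed

text \<open>Near each point of \<open>\<Omega> - {0}\<close> the distribution has a smooth density. By uniqueness these local
  densities agree on overlaps and glue to one smooth function \<open>f\<close>; that \<open>f\<close> represents \<open>T\<close> also on test
  functions with large support follows by localisation.\<close>

lemma regular_part_represents:
  fixes T :: "(real^2 \<Rightarrow> real) \<Rightarrow> 'a::euclidean_space"
  assumes \<Omega>: "open \<Omega>" and T: "T \<in> \<A> \<Omega> V"
  shows "represents_on (\<Omega> - {0}) (regular_part \<Omega> T) T"
proof -
  let ?U = "\<Omega> - {0}"
  have T': "T \<in> distributions \<Omega> V" using T by (simp add: \<A>_def)
  have "\<exists>W f. open W \<and> x \<in> W \<and> W \<subseteq> \<Omega> \<and> represents_on W f T" if "x \<in> ?U" for x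
    using T that unfolding \<A>_def singular_support_def by blast
  then obtain W h where W: "\<And>x. x \<in> ?U \<Longrightarrow> open (W x)" "\<And>x. x \<in> ?U \<Longrightarrow> x \<in> W x"
    and h: "\<And>x. x \<in> ?U \<Longrightarrow> represents_on (W x) (h x) T"
    by metis
  define f where "f x = h x x" for x
  have fh: "f y = h x y" if "x \<in> ?U" "y \<in> W x" "y \<in> ?U" for x y
    unfolding f_def using that W h represents_on_unique by blast
  have "smooth_on ?U f"
    unfolding smooth_on_def
  proof (intro allI ballI)
    fix "is" x assume x: "x \<in> ?U"
    have "open (W x \<inter> ?U)" using W(1)[OF x] \<Omega> by (intro open_Int open_delete)
    moreover have "smooth_on (W x \<inter> ?U) (h x)"
      using h[OF x] smooth_on_subset unfolding represents_on_def by blast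
    ultimately have "smooth_on (W x \<inter> ?U) f"
      using smooth_on_cong[of "W x \<inter> ?U" f "h x"] fh[OF x] by simp
    then show "pds is f differentiable (at x)"
      using W(2)[OF x] x unfolding smooth_on_def by blast
  qed
  moreover from this have f: "continuous_on ?U f"
    by (rule smooth_on_imp_continuous_on)
  have "T \<phi> = (LINT x|lborel. \<phi> x *\<^sub>R f x)" if "\<phi> \<in> test_funs ?U UNIV" for \<phi>
    using _ _ _ that
  proof (rule test_funs_localise)
    fix x assume x: "x \<in> ?U"
    have "T \<phi> = (LINT y|lborel. \<phi> y *\<^sub>R f y)" if \<phi>: "\<phi> \<in> test_funs (W x) UNIV" "\<phi> \<in> test_funs ?U UNIV" for \<phi>
    proof -
      have "T \<phi> = (LINT y|lborel. \<phi> y *\<^sub>R h x y)"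
        using h[OF x] \<phi>(1) by (simp add: represents_on_def)
      also have "(\<lambda>y. \<phi> y *\<^sub>R h x y) = (\<lambda>y. \<phi> y *\<^sub>R f y)"
      proof
        fix y
        show "\<phi> y *\<^sub>R h x y = \<phi> y *\<^sub>R f y"
          using test_funsE[OF \<phi>(1)] test_funsE[OF \<phi>(2)] fh[OF x, of y] by (metis scaleR_zero_left subsetD)
      qed
      finally show ?thesis .
    qed
    then show "\<exists>V. open V \<and> x \<in> V \<and> (\<forall>\<phi>\<in>test_funs V UNIV. \<phi> \<in> test_funs ?U UNIV \<longrightarrow>
        T \<phi> = (LINT y|lborel. \<phi> y *\<^sub>R f y))"
      using W x by blast
  next
    fix \<phi> \<psi> :: "real^2 \<Rightarrow> real"
    assume \<phi>: "\<phi> \<in> test_funs ?U UNIV" "T \<phi> = (LINT x|lborel. \<phi> x *\<^sub>R f x)"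
      and \<psi>: "\<psi> \<in> test_funs ?U UNIV" "T \<psi> = (LINT x|lborel. \<psi> x *\<^sub>R f x)"
    have "T (\<lambda>x. \<phi> x + \<psi> x) = T \<phi> + T \<psi>"
      using test_funs_mono[OF \<phi>(1), of \<Omega>] test_funs_mono[OF \<psi>(1), of \<Omega>]
      by (intro distributions_add[OF T']) auto
    then show "T (\<lambda>x. \<phi> x + \<psi> x) = (LINT x|lborel. (\<phi> x + \<psi> x) *\<^sub>R f x)"
      using \<phi> \<psi> f by (simp add: scaleR_add_left integrable_test_fun_scaleR)
  next
    show "T (\<lambda>x. 0) = (LINT x|lborel. 0 *\<^sub>R f x)"
      using distributions_zero[OF T'] by simp
  qed
  ultimately have "represents_on ?U f T"
    by (simp add: represents_on_def)
  then show ?thesis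
    unfolding regular_part_def by (rule someI[of "\<lambda>f. represents_on ?U f T"])
qed

section \<open>Functionals supported at the origin\<close>

definition vanishes_to_order :: "nat \<Rightarrow> (real^2 \<Rightarrow> real) \<Rightarrow> bool" where
  "vanishes_to_order m \<phi> \<longleftrightarrow> (\<forall>is. length is < m \<longrightarrow> pds is \<phi> 0 = 0)"

lemma vanishes_to_order_pds:
  "vanishes_to_order m \<phi> \<Longrightarrow> vanishes_to_order (m - length is) (pds is \<phi>)"
  unfolding vanishes_to_order_def pds_append[symmetric] by simp

lemma abs_frechet_derivative_le_sum_pd:
  fixes f :: "real^2 \<Rightarrow> real"
  assumes "f differentiable (at x)"
  shows "\<bar>frechet_derivative f (at x) h\<bar> \<le> (\<Sum>i\<in>UNIV. \<bar>pd i f x\<bar>) * norm h"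
proof -
  have D: "linear (frechet_derivative f (at x))"
    using assms by (rule linear_frechet_derivative)
  have "frechet_derivative f (at x) h = frechet_derivative f (at x) (\<Sum>i\<in>UNIV. (h $ i) *\<^sub>R axis i 1)"
    using basis_expansion[of h] by (simp add: scalar_mult_eq_scaleR)
  also have "\<dots> = (\<Sum>i\<in>UNIV. (h $ i) * pd i f x)"
    by (simp add: linear_sum[OF D] linear_cmul[OF D] pd_def)
  also have "\<bar>\<dots>\<bar> \<le> (\<Sum>i\<in>UNIV. \<bar>(h $ i) * pd i f x\<bar>)"
    by (rule sum_abs)
  also have "\<dots> \<le> (\<Sum>i\<in>UNIV. \<bar>pd i f x\<bar> * norm h)"
    by (intro sum_mono) (simp add: abs_mult mult.commute mult_right_mono component_le_norm_cart)
  finally show ?thesis by (simp add: sum_distrib_right)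
qed

text \<open>A weak form of Taylor's theorem. By induction, the first derivatives at \<open>y\<close> are bounded by a constant
  times \<open>norm y ^ m\<close>; the mean value inequality on the ball of radius \<open>norm x\<close> supplies one more factor
  \<open>norm x\<close>.\<close>

lemma vanishes_to_order_bound:
  assumes "smooth_on UNIV \<phi>" "vanishes_to_order m \<phi>"
  shows "\<exists>C\<ge>0. \<forall>x. norm x \<le> R \<longrightarrow> \<bar>\<phi> x\<bar> \<le> C * norm x ^ m"
  using assms
proof (induction m arbitrary: \<phi>)
  case 0
  have "bounded (\<phi> ` cball 0 R)"
    using smooth_on_imp_continuous_on[OF 0(1)] continuous_on_subset
    by (blast intro: compact_imp_bounded compact_continuous_image compact_cball)
  then obtain C where C: "\<And>x. norm x \<le> R \<Longrightarrow> \<bar>\<phi> x\<bar> \<le> C"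
    by (fastforce simp: bounded_iff)
  have "\<bar>\<phi> x\<bar> \<le> max C 0 * norm x ^ 0" if "norm x \<le> R" for x
    using C[OF that] by simp
  then show ?case by (metis max.cobounded2)
next
  case (Suc m)
  have "\<exists>C\<ge>0. \<forall>x. norm x \<le> R \<longrightarrow> \<bar>pd i \<phi> x\<bar> \<le> C * norm x ^ m" for i
    using vanishes_to_order_pds[OF Suc.prems(2), of "[i]"]
    by (intro Suc.IH smooth_on_pd Suc.prems(1)) (simp add: pds_Cons)
  then obtain C where C: "\<And>i. C i \<ge> 0" "\<And>i x. norm x \<le> R \<Longrightarrow> \<bar>pd i \<phi> x\<bar> \<le> C i * norm x ^ m"
    by metis
  have "\<bar>\<phi> x\<bar> \<le> (\<Sum>i\<in>UNIV. C i) * norm x ^ Suc m" if x: "norm x \<le> R" for x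
  proof -
    have "norm (\<phi> x - \<phi> 0) \<le> ((\<Sum>i\<in>UNIV. C i) * norm x ^ m) * norm (x - 0)"
    proof (rule differentiable_bound[where S = "cball 0 (norm x)"])
      fix y :: "real^2" assume y: "y \<in> cball 0 (norm x)"
      have d: "\<phi> differentiable (at y)"
        using smooth_on_imp_differentiable[OF Suc.prems(1)] by simp
      then show "(\<phi> has_derivative frechet_derivative \<phi> (at y)) (at y within cball 0 (norm x))"
        by (simp add: frechet_derivative_works has_derivative_at_withinI)
      have "\<bar>pd i \<phi> y\<bar> \<le> C i * norm x ^ m" for i
      proof -
        have "\<bar>pd i \<phi> y\<bar> \<le> C i * norm y ^ m" using y x by (intro C(2)) simp
        also have "\<dots> \<le> C i * norm x ^ m" using y by (intro mult_left_mono power_mono C(1)) auto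
        finally show ?thesis .
      qed
      then have "(\<Sum>i\<in>UNIV. \<bar>pd i \<phi> y\<bar>) \<le> (\<Sum>i\<in>UNIV. C i) * norm x ^ m"
        unfolding sum_distrib_right by (rule sum_mono)
      then have "norm (frechet_derivative \<phi> (at y) h) \<le> ((\<Sum>i\<in>UNIV. C i) * norm x ^ m) * norm h" for h
        using order_trans[OF abs_frechet_derivative_le_sum_pd[OF d] mult_right_mono[OF _ norm_ge_zero]]
        by simp
      then show "onorm (frechet_derivative \<phi> (at y)) \<le> (\<Sum>i\<in>UNIV. C i) * norm x ^ m"
        by (rule onorm_le)
    qed auto
    moreover have "\<phi> 0 = 0"
      using Suc.prems(2) unfolding vanishes_to_order_def by (metis list.size(3) pds_Nil zero_less_Suc)
    ultimately show ?thesis by (simp add: mult_ac)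
  qed
  moreover have "0 \<le> (\<Sum>i\<in>UNIV. C i)" using C(1) by (simp add: sum_nonneg)
  ultimately show ?case by blast
qed

text \<open>On the ball of radius \<open>2 * l\<close>, which contains the support of a cutoff function at scale \<open>l\<close>, the
  function \<open>F l\<close> has size \<open>l powr a\<close>, and each derivative costs a factor \<open>1 / l\<close>. In this form the
  orders add up under multiplication, by the product rule for first derivatives alone.\<close>

definition scaled_order :: "real \<Rightarrow> (real \<Rightarrow> real^2 \<Rightarrow> real) \<Rightarrow> bool" where
  "scaled_order a F \<longleftrightarrow> (\<forall>is. \<exists>C. \<forall>l x. 0 < l \<longrightarrow> l \<le> 1 \<longrightarrow> norm x \<le> 2 * l \<longrightarrow>
     \<bar>pds is (F l) x\<bar> \<le> C * l powr (a - length is))"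

lemma scaled_order_pd: "scaled_order a F \<Longrightarrow> scaled_order (a - 1) (\<lambda>l. pd i (F l))"
proof -
  assume F: "scaled_order a F"
  show ?thesis
    unfolding scaled_order_def
  proof
    fix "is" :: "2 list"
    show "\<exists>C. \<forall>l x. 0 < l \<longrightarrow> l \<le> 1 \<longrightarrow> norm x \<le> 2 * l \<longrightarrow>
        \<bar>pds is (pd i (F l)) x\<bar> \<le> C * l powr (a - 1 - length is)"
      using F[unfolded scaled_order_def, rule_format, of "is @ [i]"]
      by (simp add: pds_snoc algebra_simps)
  qed
qed

lemma scaled_order_mult:
  assumes "\<And>l. smooth_on UNIV (F l)" "\<And>l. smooth_on UNIV (G l)" "scaled_order a F" "scaled_order b G"
  shows "scaled_order (a + b) (\<lambda>l x. F l x * G l x)"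
  unfolding scaled_order_def
proof
  fix "is" :: "2 list"
  from assms show "\<exists>C. \<forall>l x. 0 < l \<longrightarrow> l \<le> 1 \<longrightarrow> norm x \<le> 2 * l \<longrightarrow>
      \<bar>pds is (\<lambda>x. F l x * G l x) x\<bar> \<le> C * l powr (a + b - length is)"
  proof (induction "is" arbitrary: F G a b rule: rev_induct)
    case Nil
    obtain C where C: "\<And>l x. 0 < l \<Longrightarrow> l \<le> 1 \<Longrightarrow> norm x \<le> 2 * l \<Longrightarrow> \<bar>F l x\<bar> \<le> C * l powr a"
      using Nil(3)[unfolded scaled_order_def, rule_format, of "[]"] by auto
    obtain D where D: "\<And>l x. 0 < l \<Longrightarrow> l \<le> 1 \<Longrightarrow> norm x \<le> 2 * l \<Longrightarrow> \<bar>G l x\<bar> \<le> D * l powr b"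
      using Nil(4)[unfolded scaled_order_def, rule_format, of "[]"] by auto
    have "\<bar>F l x * G l x\<bar> \<le> (C * D) * l powr (a + b)" if "0 < l" "l \<le> 1" "norm x \<le> 2 * l" for l x
    proof -
      have "\<bar>F l x * G l x\<bar> \<le> (C * l powr a) * (D * l powr b)"
        unfolding abs_mult using C[OF that] D[OF that] by (intro mult_mono) auto
      then show ?thesis by (simp add: powr_add mult_ac)
    qed
    then show ?case by auto
  next
    case (snoc i "is")
    have F: "smooth_on UNIV (F l)" "F l differentiable (at x)" for l x
      using snoc.prems(1) by (auto intro: smooth_on_imp_differentiable)
    have G: "smooth_on UNIV (G l)" "G l differentiable (at x)" for l x
      using snoc.prems(2) by (auto intro: smooth_on_imp_differentiable)
    obtain C where C: "\<And>l x. 0 < l \<Longrightarrow> l \<le> 1 \<Longrightarrow> norm x \<le> 2 * l \<Longrightarrow>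
        \<bar>pds is (\<lambda>x. pd i (F l) x * G l x) x\<bar> \<le> C * l powr (a - 1 + b - length is)"
      using snoc.IH[OF smooth_on_pd[OF F(1)] G(1) scaled_order_pd[OF snoc.prems(3)] snoc.prems(4)] by blast
    obtain D where D: "\<And>l x. 0 < l \<Longrightarrow> l \<le> 1 \<Longrightarrow> norm x \<le> 2 * l \<Longrightarrow>
        \<bar>pds is (\<lambda>x. F l x * pd i (G l) x) x\<bar> \<le> D * l powr (a + (b - 1) - length is)"
      using snoc.IH[OF F(1) smooth_on_pd[OF G(1)] snoc.prems(3) scaled_order_pd[OF snoc.prems(4)]] by blast
    have "\<bar>pds (is @ [i]) (\<lambda>x. F l x * G l x) x\<bar> \<le> (C + D) * l powr (a + b - length (is @ [i]))"
      if l: "0 < l" "l \<le> 1" "norm x \<le> 2 * l" for l x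
    proof -
      have "pd i (\<lambda>x. F l x * G l x) = (\<lambda>x. pd i (F l) x * G l x + F l x * pd i (G l) x)"
        by (intro ext pd_mult F G)
      then have "pds (is @ [i]) (\<lambda>x. F l x * G l x) x =
          pds is (\<lambda>x. pd i (F l) x * G l x) x + pds is (\<lambda>x. F l x * pd i (G l) x) x"
        using pds_add[OF smooth_on_mult[OF open_UNIV smooth_on_pd[OF F(1)] G(1)]
            smooth_on_mult[OF open_UNIV F(1) smooth_on_pd[OF G(1)]]]
        by (simp add: pds_snoc)
      moreover have "a - 1 + b - length is = a + b - length (is @ [i])"
        "a + (b - 1) - length is = a + b - length (is @ [i])" by simp_all
      ultimately show ?thesis
        using C[OF l] D[OF l] abs_triangle_ineq unfolding distrib_right by (smt (verit))
    qed
    then show ?case by blast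
  qed
qed

lemma scaled_order_dilation:
  assumes "\<eta> \<in> test_funs S UNIV"
  shows "scaled_order 0 (\<lambda>l x. \<eta> (inverse l *\<^sub>R (x - 0)))"
  unfolding scaled_order_def
proof
  fix "is" :: "2 list"
  obtain M where M: "\<And>x. norm (pds is \<eta> x) \<le> M"
    using test_funs_bounded[OF test_funs_pds[OF assms]] by blast
  have "\<bar>pds is (\<lambda>x. \<eta> (inverse l *\<^sub>R (x - 0))) x\<bar> \<le> M * l powr (0 - real (length is))" if "0 < l" for l x
  proof -
    have "l powr (0 - real (length is)) = inverse l ^ length is"
      using that by (simp add: powr_minus powr_realpow power_inverse)
    then show ?thesis
      using that M[of "inverse l *\<^sub>R (x - 0)"] unfolding pds_affine[OF test_funs_smooth[OF assms]]
      by (simp add: abs_mult mult.commute[of M] mult_left_mono)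
  qed
  then show "\<exists>C. \<forall>l x. 0 < l \<longrightarrow> l \<le> 1 \<longrightarrow> norm x \<le> 2 * l \<longrightarrow>
      \<bar>pds is (\<lambda>x. \<eta> (inverse l *\<^sub>R (x - 0))) x\<bar> \<le> C * l powr (0 - real (length is))"
    by blast
qed

lemma scaled_order_of_vanishes_to_order:
  assumes "smooth_on UNIV \<phi>" "vanishes_to_order m \<phi>"
  shows "scaled_order (real m) (\<lambda>l. \<phi>)"
  unfolding scaled_order_def
proof
  fix "is" :: "2 list"
  let ?k = "m - length is"
  obtain C where C: "C \<ge> 0" "\<And>x. norm x \<le> 2 \<Longrightarrow> \<bar>pds is \<phi> x\<bar> \<le> C * norm x ^ ?k"
    using vanishes_to_order_bound[OF smooth_on_pds[OF assms(1)] vanishes_to_order_pds[OF assms(2)]] by blast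
  have "\<bar>pds is \<phi> x\<bar> \<le> C * 2 ^ ?k * l powr (real m - length is)"
    if l: "0 < l" "l \<le> 1" "norm x \<le> 2 * l" for l x
  proof -
    have "\<bar>pds is \<phi> x\<bar> \<le> C * norm x ^ ?k" using l by (intro C(2)) simp
    also have "\<dots> \<le> C * (2 * l) ^ ?k" using l C(1) by (intro mult_left_mono power_mono) auto
    also have "\<dots> = C * 2 ^ ?k * l powr real ?k" using l by (simp add: power_mult_distrib powr_realpow)
    also have "\<dots> \<le> C * 2 ^ ?k * l powr (real m - length is)"
      using l C(1) by (intro mult_left_mono powr_mono') auto
    finally show ?thesis .
  qed
  then show "\<exists>C. \<forall>l x. 0 < l \<longrightarrow> l \<le> 1 \<longrightarrow> norm x \<le> 2 * l \<longrightarrow>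
      \<bar>pds is \<phi> x\<bar> \<le> C * l powr (real m - length is)"
    by blast
qed

text \<open>The seminorm estimate of a distribution on \<open>K\<close>, with an arbitrary bound \<open>M\<close> on the derivatives
  in place of the seminorm.\<close>

definition finite_order_on :: "(real^2) set \<Rightarrow> ((real^2 \<Rightarrow> real) \<Rightarrow> real) \<Rightarrow> bool" where
  "finite_order_on K t \<longleftrightarrow> (\<exists>C N. \<forall>\<phi>\<in>test_funs K UNIV. \<forall>M.
     (\<forall>is x. length is \<le> N \<longrightarrow> \<bar>pds is \<phi> x\<bar> \<le> M) \<longrightarrow> \<bar>t \<phi>\<bar> \<le> C * M)"

text \<open>Descending induction on the order \<open>m\<close> to which a test function vanishes at the origin, starting
  above the order \<open>N\<close> of the functional on a fixed compact ball \<open>K\<close>. The ball is chosen inside the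
  region where the scaling hypothesis applies, and it is stable under the dilations with \<open>l < 1\<close>.\<close>

lemma functional_supported_at_0_eq_0:
  fixes t :: "(real^2 \<Rightarrow> real) \<Rightarrow> real"
  assumes r: "r > 0" "ball 0 r \<subseteq> \<Omega>"
    and add: "\<And>\<phi> \<psi>. \<phi> \<in> test_funs \<Omega> UNIV \<Longrightarrow> \<psi> \<in> test_funs \<Omega> UNIV \<Longrightarrow> t (\<lambda>x. \<phi> x + \<psi> x) = t \<phi> + t \<psi>"
    and cmult: "\<And>c \<phi>. \<phi> \<in> test_funs \<Omega> UNIV \<Longrightarrow> t (\<lambda>x. c * \<phi> x) = c * t \<phi>"
    and order: "\<And>K. compact K \<Longrightarrow> K \<subseteq> \<Omega> \<Longrightarrow> finite_order_on K t"
    and supp: "\<And>\<phi>. \<phi> \<in> test_funs (\<Omega> - {0}) UNIV \<Longrightarrow> t \<phi> = 0"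
    and scale: "\<And>\<phi>. \<phi> \<in> test_funs (ball 0 r) UNIV \<Longrightarrow>
      ((\<lambda>l. t (\<lambda>x. \<phi> (inverse l *\<^sub>R x))) \<longlongrightarrow> 0) (at_right 0)"
    and \<phi>: "\<phi> \<in> test_funs \<Omega> UNIV"
  shows "t \<phi> = 0"
proof -
  obtain \<eta> :: "real^2 \<Rightarrow> real" where \<eta>: "smooth_on UNIV \<eta>" "\<And>x. norm x \<le> 1 \<Longrightarrow> \<eta> x = 1"
    "\<And>x. 2 \<le> norm x \<Longrightarrow> \<eta> x = 0" "\<And>x. 0 \<le> \<eta> x"
    using cutoff_exists by blast
  define \<theta> where "\<theta> l x = \<eta> (inverse l *\<^sub>R (x - 0))" for l and x :: "real^2"
  have \<theta>: "smooth_on UNIV (\<theta> l)" for l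
    unfolding \<theta>_def by (rule smooth_on_affine[OF \<eta>(1)])
  have \<theta>_in: "\<theta> l x = 1" if "norm x \<le> l" "0 < l" for l x
    unfolding \<theta>_def
    by (rule \<eta>(2), unfold norm_scaleR) (use that in \<open>simp add: field_simps\<close>)
  have \<theta>_out: "\<theta> l x = 0" if "2 * l \<le> norm x" "0 < l" for l x
    unfolding \<theta>_def
    by (rule \<eta>(3), unfold norm_scaleR) (use that in \<open>simp add: field_simps\<close>)
  \<comment> \<open>The factor \<open>1 - \<theta> l\<close> vanishes near the origin, so cutting off does not change \<open>t\<close>.\<close>
  have localise: "t \<phi> = t (\<lambda>x. \<phi> x * \<theta> l x)" if \<phi>: "\<phi> \<in> test_funs \<Omega> UNIV" and l: "l > 0" for \<phi> l
  proof -
    have sm: "smooth_on UNIV (\<lambda>x. 1 + (-1) * \<theta> l x)"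
      by (rule smooth_on_add[OF open_UNIV smooth_on_const smooth_on_cmult[OF open_UNIV \<theta>]])
    obtain K where K: "smooth_on UNIV \<phi>" "compact K" "K \<subseteq> \<Omega>" "\<And>x. x \<notin> K \<Longrightarrow> \<phi> x = 0"
      by (rule test_funsE[OF \<phi>]) (rule that)
    have "(\<lambda>x. \<phi> x * (1 + (-1) * \<theta> l x)) \<in> test_funs (\<Omega> - {0}) UNIV"
    proof (rule test_funsI[OF smooth_on_mult[OF open_UNIV K(1) sm]])
      show "compact (K - ball 0 l)" using K(2) by (simp add: compact_diff)
      show "K - ball 0 l \<subseteq> \<Omega> - {0}" using K(3) l by auto
      show "\<phi> x * (1 + (-1) * \<theta> l x) = 0" if "x \<notin> K - ball 0 l" for x
        using that K(4)[of x] \<theta>_in[of x l] l by (cases "x \<in> K") auto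
    qed
    then have "t (\<lambda>x. \<phi> x * (1 + (-1) * \<theta> l x)) = 0" by (rule supp)
    moreover have "t (\<lambda>x. \<phi> x * \<theta> l x + \<phi> x * (1 + (-1) * \<theta> l x)) =
        t (\<lambda>x. \<phi> x * \<theta> l x) + t (\<lambda>x. \<phi> x * (1 + (-1) * \<theta> l x))"
      by (intro add test_funs_mult \<phi> \<theta> sm)
    ultimately show ?thesis by (simp add: algebra_simps)
  qed
  define K where "K = cball (0::real^2) (r / 2)"
  have K: "compact K" "K \<subseteq> ball 0 r" "K \<subseteq> \<Omega>"
    using r by (auto simp: K_def)
  have K\<Omega>: "\<phi> \<in> test_funs \<Omega> UNIV" if "\<phi> \<in> test_funs K UNIV" for \<phi> :: "real^2 \<Rightarrow> real"
    using test_funs_mono[OF that K(3)] .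
  obtain C N where CN: "\<And>\<phi> M. \<phi> \<in> test_funs K UNIV \<Longrightarrow> (\<And>is x. length is \<le> N \<Longrightarrow> \<bar>pds is \<phi> x\<bar> \<le> M)
      \<Longrightarrow> \<bar>t \<phi>\<bar> \<le> C * M"
    using order[OF K(1,3)] unfolding finite_order_on_def by metis
  \<comment> \<open>The seminorms of \<open>\<phi> \<theta>\<^sub>l\<close> up to order \<open>N\<close> are of size \<open>l\<close>, since \<open>\<phi>\<close> vanishes to order \<open>N + 1\<close>.\<close>
  have top: "t \<phi> = 0" if \<phi>: "\<phi> \<in> test_funs K UNIV" and flat: "vanishes_to_order (Suc N) \<phi>" for \<phi>
  proof -
    have "\<eta> \<in> test_funs UNIV UNIV"
      by (rule test_funsI[OF \<eta>(1) compact_cball[of 0 2]]) (auto intro: \<eta>(3))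
    then have "scaled_order (real (Suc N) + 0) (\<lambda>l x. \<phi> x * \<theta> l x)"
      unfolding \<theta>_def using test_funs_smooth[OF \<phi>] flat
      by (intro scaled_order_mult scaled_order_dilation[of _ UNIV] scaled_order_of_vanishes_to_order
          smooth_on_affine[OF \<eta>(1)])
    then obtain D where D: "\<And>is l x. 0 < l \<Longrightarrow> l \<le> 1 \<Longrightarrow> norm x \<le> 2 * l \<Longrightarrow>
        \<bar>pds is (\<lambda>x. \<phi> x * \<theta> l x) x\<bar> \<le> D is * l powr (real (Suc N) + 0 - length is)"
      unfolding scaled_order_def by metis
    have fin: "finite {is::2 list. length is \<le> N}"
      using finite_lists_length_le[of "UNIV :: 2 set" N] by simp
    define E where "E = (\<Sum>is\<in>{is. length is \<le> N}. \<bar>D is\<bar>)"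
    have E: "\<bar>D is\<bar> \<le> E" if "length is \<le> N" for "is"
      unfolding E_def using that fin by (intro member_le_sum) auto
    have "\<bar>t \<phi>\<bar> \<le> C * (E * l)" if l: "0 < l" "l \<le> 1" for l
    proof -
      have "\<bar>pds is (\<lambda>x. \<phi> x * \<theta> l x) x\<bar> \<le> E * l" if len: "length is \<le> N" for "is" x
      proof (cases "norm x \<le> 2 * l")
        case True
        have "\<bar>pds is (\<lambda>x. \<phi> x * \<theta> l x) x\<bar> \<le> D is * l powr (real (Suc N) + 0 - length is)"
          by (rule D[OF l True])
        also have "\<dots> \<le> \<bar>D is\<bar> * l powr 1"
          using l len by (intro mult_mono powr_mono') auto
        also have "\<dots> \<le> E * l"
          using l E[OF len] by (simp add: mult_right_mono)
        finally show ?thesis .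
      next
        case False
        have "pds is (\<lambda>x. \<phi> x * \<theta> l x) x = 0"
          by (rule pds_eq_0_outside[OF compact_cball[of 0 "2 * l"]])
            (use False \<theta>_out[OF _ l(1)] in auto)
        moreover have "0 \<le> E" unfolding E_def by (simp add: sum_nonneg)
        ultimately show ?thesis using l by simp
      qed
      then have "\<bar>t (\<lambda>x. \<phi> x * \<theta> l x)\<bar> \<le> C * (E * l)"
        by (intro CN test_funs_mult \<phi> \<theta>)
      then show ?thesis by (simp flip: localise[OF K\<Omega>[OF \<phi>] l(1)])
    qed
    then have "eventually (\<lambda>l. \<bar>t \<phi>\<bar> \<le> C * (E * l)) (at_right 0)"
      by (auto simp: eventually_at_right_field intro!: exI[of _ 1])
    moreover have "((\<lambda>l. C * (E * l)) \<longlongrightarrow> C * (E * 0)) (at_right 0)"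
      by (intro tendsto_intros)
    ultimately have "\<bar>t \<phi>\<bar> \<le> C * (E * 0)"
      by (intro tendsto_lowerbound[of _ _ "at_right 0"]) auto
    then show ?thesis by simp
  qed
  have all: "t \<phi> = 0" if "m \<le> Suc N" "\<phi> \<in> test_funs K UNIV" "vanishes_to_order m \<phi>" for m \<phi>
    using that
  proof (induction m arbitrary: \<phi> rule: inc_induct)
    case base
    then show ?case by (rule top)
  next
    case (step m)
    have sm: "smooth_on UNIV \<phi>" using step.prems(1) by (rule test_funs_smooth)
    have "\<bar>t \<phi>\<bar> \<le> \<bar>t (\<lambda>x. \<phi> (inverse l *\<^sub>R x))\<bar>" if l: "0 < l" "l < 1" for l
    proof -
      define \<phi>l where "\<phi>l x = \<phi> (inverse l *\<^sub>R (x - 0))" for x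
      have sl: "smooth_on UNIV \<phi>l"
        unfolding \<phi>l_def by (rule smooth_on_affine[OF sm])
      have "(\<lambda>x. l *\<^sub>R x) ` K \<subseteq> K"
      proof (clarsimp simp: K_def)
        fix x :: "real^2" assume "norm x * 2 \<le> r"
        then show "\<bar>l\<bar> * norm x * 2 \<le> r"
          using l mult_left_le_one_le[of "norm x" l] by simp
      qed
      from test_funs_dilate[OF step.prems(1) l(1) this] have \<phi>l: "\<phi>l \<in> test_funs K UNIV"
        by (simp add: \<phi>l_def[abs_def])
      \<comment> \<open>The derivatives of order \<open>m\<close> at 0 cancel, so the induction hypothesis applies to \<open>\<psi>\<close>.\<close>
      define \<psi> where "\<psi> x = l ^ m * \<phi>l x + (-1) * \<phi> x" for x
      have "\<psi> \<in> test_funs K UNIV"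
        unfolding \<psi>_def by (intro test_funs_add test_funs_cmult \<phi>l step.prems)
      moreover have "vanishes_to_order (Suc m) \<psi>"
        unfolding vanishes_to_order_def
      proof (intro allI impI)
        fix "is" :: "2 list" assume len: "length is < Suc m"
        have "pds is \<psi> 0 = l ^ m * (inverse l ^ length is * pds is \<phi> 0) + (-1) * pds is \<phi> 0"
          unfolding \<psi>_def
            pds_add[OF smooth_on_cmult[OF open_UNIV sl] smooth_on_cmult[OF open_UNIV sm]]
            pds_cmult[OF sl] pds_cmult[OF sm]
          by (simp add: \<phi>l_def[abs_def] pds_affine[OF sm, of _ _ 0, simplified])
        also have "\<dots> = 0"
        proof (cases "length is = m")
          case True
          then show ?thesis using l by (simp add: power_inverse)
        next
          case False
          then show ?thesis using len step.prems(2) by (simp add: vanishes_to_order_def)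
        qed
        finally show "pds is \<psi> 0 = 0" .
      qed
      ultimately have "t \<psi> = 0" by (rule step.IH)
      moreover have "t \<psi> = l ^ m * t \<phi>l + (-1) * t \<phi>"
        unfolding \<psi>_def
        by (simp only: add[OF K\<Omega>[OF test_funs_cmult[OF \<phi>l]] K\<Omega>[OF test_funs_cmult[OF step.prems(1)]]]
            cmult[OF K\<Omega>[OF \<phi>l]] cmult[OF K\<Omega>[OF step.prems(1)]])
      ultimately have "t \<phi> = l ^ m * t \<phi>l" by simp
      then have "\<bar>t \<phi>\<bar> = l ^ m * \<bar>t \<phi>l\<bar>"
        using l by (simp add: abs_mult)
      also have "\<dots> \<le> 1 * \<bar>t \<phi>l\<bar>"
        using l by (intro mult_right_mono power_le_one) auto
      finally show ?thesis by (simp add: \<phi>l_def[abs_def])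
    qed
    then have "eventually (\<lambda>l. \<bar>t \<phi>\<bar> \<le> \<bar>t (\<lambda>x. \<phi> (inverse l *\<^sub>R x))\<bar>) (at_right 0)"
      by (auto simp: eventually_at_right_field intro!: exI[of _ 1])
    moreover have "((\<lambda>l. \<bar>t (\<lambda>x. \<phi> (inverse l *\<^sub>R x))\<bar>) \<longlongrightarrow> \<bar>0\<bar>) (at_right 0)"
      by (intro tendsto_rabs scale test_funs_mono[OF step.prems(1) K(2)])
    ultimately have "\<bar>t \<phi>\<bar> \<le> \<bar>0\<bar>"
      by (intro tendsto_lowerbound[of _ _ "at_right 0"]) auto
    then show ?case by simp
  qed
  have "(\<lambda>x. \<theta> (r / 4) x * \<phi> x) \<in> test_funs K UNIV"
    unfolding \<theta>_def K_def using r(1)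
    by (intro test_funs_mult test_funs_smooth[OF \<phi>] test_funs_affine[where R = 2] \<eta>) auto
  then have "t (\<lambda>x. \<phi> x * \<theta> (r / 4) x) = 0"
    using all[of 0] by (simp add: vanishes_to_order_def mult.commute)
  then show ?thesis
    using localise[OF \<phi>, of "r / 4"] r(1) by simp
qed

section \<open>Scaling degree and tensor components\<close>

lemma act_scaleR:
  assumes "\<And>c. T (\<lambda>x. c * \<phi> x) = c *\<^sub>R T \<phi>"
  shows "act T (\<lambda>x. \<phi> x *\<^sub>R v) = v \<bullet> T \<phi>"
proof -
  have "act T (\<lambda>x. \<phi> x *\<^sub>R v) = (\<Sum>b\<in>Basis. (v \<bullet> b) * (T \<phi> \<bullet> b))"
    unfolding act_def inner_scaleR_left mult.commute[of _ "v \<bullet> _"] assms by simp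
  also have "\<dots> = v \<bullet> T \<phi>"
    by (rule euclidean_inner[symmetric])
  finally show ?thesis .
qed

text \<open>A scaling degree below \<open>d\<close> provides an exponent \<open>k < d\<close> with \<open>l powr k * T (\<phi>\<^sub>l) \<rightarrow> 0\<close>, and the remaining
  factor \<open>l powr (d - k)\<close> tends to 0. The exponent \<open>d - 2\<close> comes from the normalisation
  \<open>\<phi>\<^sub>l = l\<^sup>-\<^sup>2 \<phi>(\<cdot>/l)\<close>. Vector valued test functions \<open>\<phi> v\<close> with a fixed direction \<open>v\<close> in \<open>V\<close> extract the
  components of \<open>T\<close>.\<close>

lemma tendsto_of_scaling_degree_less:
  fixes T :: "(real^2 \<Rightarrow> real) \<Rightarrow> 'a::euclidean_space"
  assumes T: "T \<in> distributions \<Omega> V" and \<Omega>: "open \<Omega>" "0 \<in> \<Omega>"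
    and deg: "scaling_degree \<Omega> V T < ereal d"
  obtains r where "r > 0" "ball 0 r \<subseteq> \<Omega>"
    "\<And>\<phi> v. \<phi> \<in> test_funs (ball 0 r) UNIV \<Longrightarrow> range (\<lambda>c. c *\<^sub>R v) \<subseteq> V \<Longrightarrow>
      ((\<lambda>l. l powr (d - 2) * (v \<bullet> T (\<lambda>x. \<phi> (inverse l *\<^sub>R x)))) \<longlongrightarrow> 0) (at_right 0)"
proof -
  define r where "r = (SOME r. 0 < r \<and> ball (0::real^2) r \<subseteq> \<Omega>)"
  have "\<exists>r>0. ball 0 r \<subseteq> \<Omega>" using \<Omega> open_contains_ball by blast
  then have r: "0 < r" "ball 0 r \<subseteq> \<Omega>"
    unfolding r_def by (metis (mono_tags, lifting) someI_ex)+
  obtain k where k: "k < d" "\<And>\<psi>. \<psi> \<in> test_funs (ball 0 r) V \<Longrightarrow>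
      ((\<lambda>l. l powr k * act T (rescale l \<psi>)) \<longlongrightarrow> 0) (at_right 0)"
    using deg unfolding scaling_degree_def Let_def r_def[symmetric] Inf_less_iff by auto
  have "((\<lambda>l. l powr (d - 2) * (v \<bullet> T (\<lambda>x. \<phi> (inverse l *\<^sub>R x)))) \<longlongrightarrow> 0) (at_right 0)"
    if \<phi>: "\<phi> \<in> test_funs (ball 0 r) UNIV" and v: "range (\<lambda>c. c *\<^sub>R v) \<subseteq> V" for \<phi> v
  proof -
    have "(\<lambda>x. \<phi> x *\<^sub>R v) \<in> test_funs (ball 0 r) V"
      by (rule test_funs_bounded_linear[OF \<phi> bounded_linear_scaleR_left v])
    from k(2)[OF this]
    have "((\<lambda>l. l powr (d - k) * (l powr k * act T (rescale l (\<lambda>x. \<phi> x *\<^sub>R v)))) \<longlongrightarrow> 0 * 0) (at_right 0)"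
      using k(1)
      by (intro tendsto_mult tendsto_zero_powrI[of "\<lambda>l. l" _ "\<lambda>l. d - k" "d - k"])
        (auto intro!: tendsto_eq_intros simp: eventually_at_right_field intro: exI[of _ 1])
    moreover have "\<forall>\<^sub>F l in at_right 0. l powr (d - k) * (l powr k * act T (rescale l (\<lambda>x. \<phi> x *\<^sub>R v))) =
        l powr (d - 2) * (v \<bullet> T (\<lambda>x. \<phi> (inverse l *\<^sub>R x)))"
      unfolding eventually_at_right_field
    proof (intro exI[of _ 1] conjI allI impI)
      fix l :: real assume l: "0 < l" "l < 1"
      have "l * norm x < r" if "norm x < r" for x :: "real^2"
        using l mult_left_le_one_le[of "norm x" l] that by simp
      then have "(\<lambda>x. l *\<^sub>R x) ` ball 0 r \<subseteq> \<Omega>"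
        using r(2) l by (force simp: subset_iff)
      from test_funs_dilate[OF \<phi> l(1) this]
      have \<phi>l: "(\<lambda>x. \<phi> (inverse l *\<^sub>R x)) \<in> test_funs \<Omega> UNIV" .
      have "rescale l (\<lambda>x. \<phi> x *\<^sub>R v) = (\<lambda>x. (1 / l\<^sup>2 * \<phi> (inverse l *\<^sub>R x)) *\<^sub>R v)"
        by (simp add: rescale_def)
      moreover have "act T (\<lambda>x. (1 / l\<^sup>2 * \<phi> (inverse l *\<^sub>R x)) *\<^sub>R v) =
          v \<bullet> T (\<lambda>x. 1 / l\<^sup>2 * \<phi> (inverse l *\<^sub>R x))"
        by (rule act_scaleR, rule distributions_cmult[OF T test_funs_cmult[OF \<phi>l]])
      ultimately have "act T (rescale l (\<lambda>x. \<phi> x *\<^sub>R v)) = v \<bullet> T (\<lambda>x. 1 / l\<^sup>2 * \<phi> (inverse l *\<^sub>R x))"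
        by simp
      also have "\<dots> = 1 / l\<^sup>2 * (v \<bullet> T (\<lambda>x. \<phi> (inverse l *\<^sub>R x)))"
        by (simp only: distributions_cmult[OF T \<phi>l] inner_scaleR_right)
      finally have "l powr (d - k) * (l powr k * act T (rescale l (\<lambda>x. \<phi> x *\<^sub>R v))) =
          (l powr (d - k) * l powr k / l\<^sup>2) * (v \<bullet> T (\<lambda>x. \<phi> (inverse l *\<^sub>R x)))"
        by simp
      also have "l powr (d - k) * l powr k / l\<^sup>2 = l powr (d - 2)"
        using l by (simp add: powr_diff)
      finally show "l powr (d - k) * (l powr k * act T (rescale l (\<lambda>x. \<phi> x *\<^sub>R v))) =
          l powr (d - 2) * (v \<bullet> T (\<lambda>x. \<phi> (inverse l *\<^sub>R x)))" .
    qed simp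
    ultimately show ?thesis
      by (simp add: Lim_transform_eventually)
  qed
  with r show thesis by (rule that)
qed

lemma bounded_linear_component2: "bounded_linear (\<lambda>A::real^2^2. A $ i $ j)"
  by (rule bounded_linear_compose[OF bounded_linear_vec_nth bounded_linear_vec_nth])

text \<open>The degree of a stress field is tested with symmetric tensors only. Its components are still
  accessible, since its values are symmetric.\<close>

lemma Sym_component: "A \<in> Sym \<Longrightarrow> (axis i (axis j 1) + axis j (axis i 1)) \<bullet> A = 2 * (A $ i $ j)"
  by (auto simp: Sym_def transpose_def vec_eq_iff inner_add_left inner_axis')

lemma scaleR_Sym: "c *\<^sub>R (axis i (axis j 1) + axis j (axis i 1)) \<in> Sym"
  by (auto simp: Sym_def transpose_def vec_eq_iff axis_def)

section \<open>The equilibrium condition\<close>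

lemma Div_cmult:
  assumes "\<sigma> \<in> distributions \<Omega> V" "\<phi> \<in> test_funs \<Omega> UNIV"
  shows "Div \<sigma> (\<lambda>x. c * \<phi> x) = c *\<^sub>R Div \<sigma> \<phi>"
proof -
  have "pd j (\<lambda>x. c * \<phi> x) = (\<lambda>x. c * pd j \<phi> x)" for j
    using pds_cmult[OF test_funs_smooth[OF assms(2)], of "[j]" c] by (simp add: pds_Cons)
  then show ?thesis
    using distributions_cmult[OF assms(1) test_funs_pd[OF assms(2)]]
    by (simp add: Div_def vec_eq_iff sum_distrib_left)
qed

lemma Div_add:
  assumes "\<sigma> \<in> distributions \<Omega> V" "\<phi> \<in> test_funs \<Omega> UNIV" "\<psi> \<in> test_funs \<Omega> UNIV"
  shows "Div \<sigma> (\<lambda>x. \<phi> x + \<psi> x) = Div \<sigma> \<phi> + Div \<sigma> \<psi>"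
proof -
  have "pd j (\<lambda>x. \<phi> x + \<psi> x) = (\<lambda>x. pd j \<phi> x + pd j \<psi> x)" for j
    using pds_add[OF assms(2,3)[THEN test_funs_smooth], of "[j]"] by (simp add: pds_Cons)
  then show ?thesis
    using distributions_add[OF assms(1) assms(2,3)[THEN test_funs_pd]]
    by (simp add: Div_def vec_eq_iff sum.distrib[symmetric])
qed

lemma equilibrium_iff_components:
  assumes \<sigma>: "\<sigma> \<in> distributions \<Omega> V" and B: "B \<in> distributions \<Omega> W"
  shows "equilibrium \<Omega> \<sigma> B \<longleftrightarrow> (\<forall>i. \<forall>\<phi>\<in>test_funs \<Omega> UNIV. (Div \<sigma> \<phi> + B \<phi>) $ i = 0)"
proof
  assume eq: "equilibrium \<Omega> \<sigma> B"
  show "\<forall>i. \<forall>\<phi>\<in>test_funs \<Omega> UNIV. (Div \<sigma> \<phi> + B \<phi>) $ i = 0"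
  proof (intro allI ballI)
    fix i and \<phi> :: "real^2 \<Rightarrow> real" assume \<phi>: "\<phi> \<in> test_funs \<Omega> UNIV"
    have "(\<lambda>x. \<phi> x *\<^sub>R axis i 1) \<in> test_funs \<Omega> (UNIV :: (real^2) set)"
      by (rule test_funs_bounded_linear[OF \<phi> bounded_linear_scaleR_left]) simp
    then have "act (Div \<sigma>) (\<lambda>x. \<phi> x *\<^sub>R axis i 1) + act B (\<lambda>x. \<phi> x *\<^sub>R axis i 1) = 0"
      using eq by (simp add: equilibrium_def)
    moreover have "act (Div \<sigma>) (\<lambda>x. \<phi> x *\<^sub>R axis i 1) = axis i 1 \<bullet> Div \<sigma> \<phi>"
      by (rule act_scaleR, rule Div_cmult[OF \<sigma> \<phi>])
    moreover have "act B (\<lambda>x. \<phi> x *\<^sub>R axis i 1) = axis i 1 \<bullet> B \<phi>"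
      by (rule act_scaleR, rule distributions_cmult[OF B \<phi>])
    ultimately show "(Div \<sigma> \<phi> + B \<phi>) $ i = 0"
      by (simp add: inner_axis')
  qed
next
  assume t: "\<forall>i. \<forall>\<phi>\<in>test_funs \<Omega> UNIV. (Div \<sigma> \<phi> + B \<phi>) $ i = 0"
  show "equilibrium \<Omega> \<sigma> B"
    unfolding equilibrium_def
  proof
    fix \<psi> :: "real^2 \<Rightarrow> real^2" assume \<psi>: "\<psi> \<in> test_funs \<Omega> UNIV"
    have "(\<lambda>x. \<psi> x $ i) \<in> test_funs \<Omega> UNIV" for i
      by (rule test_funs_bounded_linear[OF \<psi> bounded_linear_vec_nth]) simp
    then have "Div \<sigma> (\<lambda>x. \<psi> x $ i) $ i + B (\<lambda>x. \<psi> x $ i) $ i = 0" for i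
      using t by simp
    then show "act (Div \<sigma>) \<psi> + act B \<psi> = 0"
      by (simp add: act_vector sum.distrib[symmetric])
  qed
qed

text \<open>Away from the origin, integration by parts turns the distributional divergence into the classical
  one.\<close>

lemma Div_plus_represented:
  assumes U: "open U" and \<sigma>: "represents_on U s \<sigma>" and B: "represents_on U b B"
    and \<phi>: "\<phi> \<in> test_funs U UNIV"
  shows "continuous_on U (\<lambda>x. (div_field s x + b x) $ i)"
    and "(Div \<sigma> \<phi> + B \<phi>) $ i = (LINT x|lborel. \<phi> x * (div_field s x + b x) $ i)"
proof -
  have s: "smooth_on U s" and b: "smooth_on U b"
    using \<sigma> B by (simp_all add: represents_on_def)
  have sij: "smooth_on U (\<lambda>y. s y $ i $ j)" for j
    by (rule smooth_on_bounded_linear[OF U bounded_linear_component2 s])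
  have bi: "continuous_on U (\<lambda>x. b x $ i)"
    using smooth_on_imp_continuous_on[OF b] by (intro continuous_intros)
  have pds: "continuous_on U (\<lambda>x. pd j (\<lambda>y. s y $ i $ j) x)" for j
    using smooth_on_imp_continuous_on[OF smooth_on_pd[OF sij]] .
  have f: "(div_field s x + b x) $ i = (\<Sum>j\<in>UNIV. pd j (\<lambda>y. s y $ i $ j) x) + b x $ i" for x
    by (simp add: div_field_def)
  show "continuous_on U (\<lambda>x. (div_field s x + b x) $ i)"
    unfolding f by (intro continuous_intros pds bi)
  have "\<sigma> (pd j \<phi>) $ i $ j = - (LINT x|lborel. \<phi> x * pd j (\<lambda>y. s y $ i $ j) x)" for j
  proof -
    have "\<sigma> (pd j \<phi>) $ i $ j = (LINT x|lborel. pd j \<phi> x *\<^sub>R s x) $ i $ j"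
      using \<sigma> test_funs_pd[OF \<phi>] by (simp add: represents_on_def)
    also have "\<dots> = (LINT x|lborel. pd j \<phi> x * s x $ i $ j)"
      using integral_test_fun_bounded_linear[OF bounded_linear_component2 test_funs_pd[OF \<phi>]
          smooth_on_imp_continuous_on[OF s]] by simp
    also have "\<dots> = - (LINT x|lborel. \<phi> x * pd j (\<lambda>y. s y $ i $ j) x)"
      by (rule integration_by_parts[OF U \<phi> sij])
    finally show ?thesis .
  qed
  moreover have "B \<phi> $ i = (LINT x|lborel. \<phi> x * b x $ i)"
    using B \<phi> integral_test_fun_bounded_linear[OF bounded_linear_vec_nth \<phi> smooth_on_imp_continuous_on[OF b]]
    by (simp add: represents_on_def)
  ultimately have "(Div \<sigma> \<phi> + B \<phi>) $ i =
      (\<Sum>j\<in>UNIV. LINT x|lborel. \<phi> x * pd j (\<lambda>y. s y $ i $ j) x) + (LINT x|lborel. \<phi> x * b x $ i)"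
    by (simp add: Div_def)
  also have "\<dots> = (LINT x|lborel. (\<Sum>j\<in>UNIV. \<phi> x * pd j (\<lambda>y. s y $ i $ j) x) + \<phi> x * b x $ i)"
    by (simp add: integrable_test_fun_mult[OF \<phi> pds] integrable_test_fun_mult[OF \<phi> bi])
  also have "\<dots> = (LINT x|lborel. \<phi> x * (div_field s x + b x) $ i)"
    unfolding f by (simp add: distrib_left sum_distrib_left)
  finally show "(Div \<sigma> \<phi> + B \<phi>) $ i = (LINT x|lborel. \<phi> x * (div_field s x + b x) $ i)" .
qed

lemma pointwise_equilibrium_iff_away_from_0:
  assumes \<Omega>: "open \<Omega>" and \<sigma>: "\<sigma> \<in> \<A> \<Omega> V" and B: "B \<in> \<A> \<Omega> W"
  shows "pointwise_equilibrium \<Omega> \<sigma> B \<longleftrightarrow>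
    (\<forall>i. \<forall>\<phi>\<in>test_funs (\<Omega> - {0}) UNIV. (Div \<sigma> \<phi> + B \<phi>) $ i = 0)"
proof -
  let ?U = "\<Omega> - {0}" and ?u = "\<lambda>i x. (div_field (regular_part \<Omega> \<sigma>) x + regular_part \<Omega> B x) $ i"
  have U: "open ?U" using \<Omega> by (rule open_delete)
  note rep = Div_plus_represented[OF U regular_part_represents[OF \<Omega> \<sigma>] regular_part_represents[OF \<Omega> B]]
  have zero: "(\<lambda>x. 0) \<in> test_funs ?U (UNIV :: real set)"
    by (rule test_funsI[of _ "{}"]) (simp_all add: smooth_on_const)
  show ?thesis
  proof
    assume "pointwise_equilibrium \<Omega> \<sigma> B"
    then have u: "?u i x = 0" if "x \<in> ?U" for i x
      using that by (simp add: pointwise_equilibrium_def)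
    show "\<forall>i. \<forall>\<phi>\<in>test_funs ?U UNIV. (Div \<sigma> \<phi> + B \<phi>) $ i = 0"
    proof (intro allI ballI)
      fix i and \<phi> :: "real^2 \<Rightarrow> real" assume \<phi>: "\<phi> \<in> test_funs ?U UNIV"
      obtain K where K: "K \<subseteq> ?U" "\<And>x. x \<notin> K \<Longrightarrow> \<phi> x = 0"
        by (rule test_funsE[OF \<phi>]) (rule that)
      have "\<phi> x * ?u i x = 0" for x
        using K u[of x i] by (cases "x \<in> K") auto
      then show "(Div \<sigma> \<phi> + B \<phi>) $ i = 0"
        by (simp only: rep(2)[OF \<phi>] Bochner_Integration.integral_zero)
    qed
  next
    assume t: "\<forall>i. \<forall>\<phi>\<in>test_funs ?U UNIV. (Div \<sigma> \<phi> + B \<phi>) $ i = 0"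
    have "?u i x = 0" if "x \<in> ?U" for i x
      using rep(1)[OF zero]
    proof (rule eq_0_of_integral_test_funs_eq_0[OF U _ _ that])
      fix \<phi> :: "real^2 \<Rightarrow> real" assume \<phi>: "\<phi> \<in> test_funs ?U UNIV"
      show "(LINT x|lborel. \<phi> x * ?u i x) = 0"
        unfolding rep(2)[OF \<phi>, symmetric] using t \<phi> by blast
    qed
    then show "pointwise_equilibrium \<Omega> \<sigma> B"
      unfolding pointwise_equilibrium_def by (auto simp: vec_eq_iff)
  qed
qed

lemma finite_order_Div_plus:
  assumes \<sigma>: "\<sigma> \<in> distributions \<Omega> V" and B: "B \<in> distributions \<Omega> W" and K: "compact K" "K \<subseteq> \<Omega>"
  shows "finite_order_on K (\<lambda>\<phi>. (Div \<sigma> \<phi> + B \<phi>) $ i)"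
proof -
  obtain C N where CN: "C \<ge> 0" "\<And>\<phi> M. \<phi> \<in> test_funs K UNIV \<Longrightarrow>
      (\<And>is x. length is \<le> N \<Longrightarrow> \<bar>pds is \<phi> x\<bar> \<le> M) \<Longrightarrow> norm (\<sigma> \<phi>) \<le> C * M"
    using distributions_bound[OF \<sigma> K] by metis
  obtain C' N' where CN': "C' \<ge> 0" "\<And>\<phi> M. \<phi> \<in> test_funs K UNIV \<Longrightarrow>
      (\<And>is x. length is \<le> N' \<Longrightarrow> \<bar>pds is \<phi> x\<bar> \<le> M) \<Longrightarrow> norm (B \<phi>) \<le> C' * M"
    using distributions_bound[OF B K] by metis
  have "\<bar>(Div \<sigma> \<phi> + B \<phi>) $ i\<bar> \<le> (2 * C + C') * M"
    if \<phi>: "\<phi> \<in> test_funs K UNIV"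
      and M: "\<And>is x. length is \<le> max (Suc N) N' \<Longrightarrow> \<bar>pds is \<phi> x\<bar> \<le> M" for \<phi> M
  proof -
    have \<sigma>j: "\<bar>\<sigma> (pd j \<phi>) $ i $ j\<bar> \<le> C * M" for j
    proof -
      have "\<bar>\<sigma> (pd j \<phi>) $ i $ j\<bar> \<le> norm (\<sigma> (pd j \<phi>) $ i)" by (rule component_le_norm_cart)
      also have "\<dots> \<le> norm (\<sigma> (pd j \<phi>))" by (rule Finite_Cartesian_Product.norm_nth_le)
      also have "\<dots> \<le> C * M"
      proof (rule CN(2)[OF test_funs_pd[OF \<phi>]])
        show "\<bar>pds is (pd j \<phi>) x\<bar> \<le> M" if "length is \<le> N" for "is" x
          using M[of "is @ [j]" x] that by (simp add: pds_snoc)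
      qed
      finally show ?thesis .
    qed
    have "\<bar>B \<phi> $ i\<bar> \<le> norm (B \<phi>)" by (rule component_le_norm_cart)
    also have "\<dots> \<le> C' * M" by (rule CN'(2)[OF \<phi>]) (use M in simp)
    finally have "\<bar>B \<phi> $ i\<bar> \<le> C' * M" .
    then show ?thesis
      using \<sigma>j[of 1] \<sigma>j[of 2] by (simp add: Div_def sum_2 algebra_simps)
  qed
  then show ?thesis
    unfolding finite_order_on_def by blast
qed

text \<open>The partial derivative of a dilated function is \<open>1/l\<close> times a dilated function. Hence the stress
  contributes terms \<open>l\<^sup>-\<^sup>1 \<sigma> ((\<partial>\<^sub>j \<phi>)(\<cdot>/l))\<close>, which tend to 0 for scaling degree below 1, and the body
  force contributes \<open>B (\<phi>(\<cdot>/l))\<close>, which tends to 0 for scaling degree below 2.\<close>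

lemma tendsto_Div_plus_dilate:
  assumes \<Omega>: "open \<Omega>" "0 \<in> \<Omega>" and \<sigma>: "\<sigma> \<in> distributions \<Omega> Sym" and B: "B \<in> distributions \<Omega> UNIV"
    and deg: "div_degree \<Omega> Sym \<sigma> < -1" "div_degree \<Omega> UNIV B < 0"
  obtains r where "r > 0" "ball 0 r \<subseteq> \<Omega>"
    "\<And>\<phi> i. \<phi> \<in> test_funs (ball 0 r) UNIV \<Longrightarrow>
      ((\<lambda>l. (Div \<sigma> (\<lambda>x. \<phi> (inverse l *\<^sub>R x)) + B (\<lambda>x. \<phi> (inverse l *\<^sub>R x))) $ i) \<longlongrightarrow> 0) (at_right 0)"
proof -
  have "x < ereal 1" if "x - 2 < -1" for x :: ereal
    using that by (cases x) (auto simp: one_ereal_def numeral_eq_ereal)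
  moreover have "x < ereal 2" if "x - 2 < 0" for x :: ereal
    using that by (cases x) (auto simp: zero_ereal_def numeral_eq_ereal)
  ultimately have deg': "scaling_degree \<Omega> Sym \<sigma> < ereal 1" "scaling_degree \<Omega> UNIV B < ereal 2"
    using deg unfolding div_degree_def by blast+
  \<comment> \<open>The two degrees are applied separately, so a common radius is taken at the end.\<close>
  obtain r where r: "r > 0" "ball 0 r \<subseteq> \<Omega>" "\<And>\<phi> S. \<phi> \<in> test_funs (ball 0 r) UNIV \<Longrightarrow>
      range (\<lambda>c. c *\<^sub>R S) \<subseteq> Sym \<Longrightarrow>
      ((\<lambda>l. l powr (1 - 2) * (S \<bullet> \<sigma> (\<lambda>x. \<phi> (inverse l *\<^sub>R x)))) \<longlongrightarrow> 0) (at_right 0)"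
    by (rule tendsto_of_scaling_degree_less[OF \<sigma> \<Omega> deg'(1)]) (rule that)
  obtain r' where r': "r' > 0" "ball 0 r' \<subseteq> \<Omega>" "\<And>\<phi> v. \<phi> \<in> test_funs (ball 0 r') UNIV \<Longrightarrow>
      range (\<lambda>c. c *\<^sub>R v) \<subseteq> UNIV \<Longrightarrow>
      ((\<lambda>l. l powr (2 - 2) * (v \<bullet> B (\<lambda>x. \<phi> (inverse l *\<^sub>R x)))) \<longlongrightarrow> 0) (at_right 0)"
    by (rule tendsto_of_scaling_degree_less[OF B \<Omega> deg'(2)]) (rule that)
  define \<rho> where "\<rho> = min r r'"
  have \<rho>: "\<rho> > 0" "ball 0 \<rho> \<subseteq> \<Omega>" "ball 0 \<rho> \<subseteq> ball (0::real^2) r" "ball 0 \<rho> \<subseteq> ball (0::real^2) r'"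
    using r r' by (auto simp: \<rho>_def)
  have "((\<lambda>l. (Div \<sigma> (\<lambda>x. \<phi> (inverse l *\<^sub>R x)) + B (\<lambda>x. \<phi> (inverse l *\<^sub>R x))) $ i) \<longlongrightarrow> 0) (at_right 0)"
    if \<phi>: "\<phi> \<in> test_funs (ball 0 \<rho>) UNIV" for \<phi> i
  proof -
    define S :: "2 \<Rightarrow> real^2^2" where "S j = axis i (axis j 1) + axis j (axis i 1)" for j
    have S: "range (\<lambda>c. c *\<^sub>R S j) \<subseteq> Sym" for j
      using scaleR_Sym by (auto simp: S_def)
    have pd: "pd j \<phi> \<in> test_funs (ball 0 r) UNIV" for j
      using test_funs_mono[OF test_funs_pd[OF \<phi>] \<rho>(3)] .
    have "((\<lambda>l. (\<Sum>j\<in>UNIV. - (l powr (1 - 2) * (S j \<bullet> \<sigma> (\<lambda>x. pd j \<phi> (inverse l *\<^sub>R x))) / 2)) +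
        l powr (2 - 2) * (axis i 1 \<bullet> B (\<lambda>x. \<phi> (inverse l *\<^sub>R x)))) \<longlongrightarrow> (\<Sum>j\<in>(UNIV::2 set). - (0 / 2)) + 0) (at_right 0)"
      by (intro tendsto_intros r(3) r'(3) pd S test_funs_mono[OF \<phi> \<rho>(4)] subset_UNIV) simp
    moreover have "\<forall>\<^sub>F l in at_right 0. (\<Sum>j\<in>UNIV. - (l powr (1 - 2) * (S j \<bullet> \<sigma> (\<lambda>x. pd j \<phi> (inverse l *\<^sub>R x))) / 2)) +
        l powr (2 - 2) * (axis i 1 \<bullet> B (\<lambda>x. \<phi> (inverse l *\<^sub>R x))) =
        (Div \<sigma> (\<lambda>x. \<phi> (inverse l *\<^sub>R x)) + B (\<lambda>x. \<phi> (inverse l *\<^sub>R x))) $ i"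
      unfolding eventually_at_right_field
    proof (intro exI[of _ 1] conjI allI impI)
      fix l :: real assume l: "0 < l" "l < 1"
      have "l * norm x < \<rho>" if "norm x < \<rho>" for x :: "real^2"
        using l mult_left_le_one_le[of "norm x" l] that by simp
      then have img: "(\<lambda>x. l *\<^sub>R x) ` ball 0 \<rho> \<subseteq> \<Omega>"
        using \<rho>(2) l by (force simp: subset_iff)
      have pdl: "(\<lambda>x. pd j \<phi> (inverse l *\<^sub>R x)) \<in> test_funs \<Omega> UNIV" for j
        by (rule test_funs_dilate[OF test_funs_pd[OF \<phi>] l(1) img])
      have "pd j (\<lambda>x. \<phi> (inverse l *\<^sub>R x)) = (\<lambda>x. inverse l * pd j \<phi> (inverse l *\<^sub>R x))" for j
        using pds_affine[OF test_funs_smooth[OF \<phi>], of "[j]" "inverse l" 0] by (simp add: pds_Cons)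
      then have "\<sigma> (pd j (\<lambda>x. \<phi> (inverse l *\<^sub>R x))) = inverse l *\<^sub>R \<sigma> (\<lambda>x. pd j \<phi> (inverse l *\<^sub>R x))" for j
        by (simp only: distributions_cmult[OF \<sigma> pdl])
      moreover have "\<sigma> (\<lambda>x. pd j \<phi> (inverse l *\<^sub>R x)) \<in> Sym" for j
        using \<sigma> pdl by (simp add: distributions_def)
      then have "S j \<bullet> \<sigma> (\<lambda>x. pd j \<phi> (inverse l *\<^sub>R x)) = 2 * \<sigma> (\<lambda>x. pd j \<phi> (inverse l *\<^sub>R x)) $ i $ j" for j
        unfolding S_def by (rule Sym_component)
      moreover have "l powr (1 - 2) = inverse l" "l powr (2 - 2) = 1"
        using l by (simp_all add: powr_minus)
      ultimately show "(\<Sum>j\<in>UNIV. - (l powr (1 - 2) * (S j \<bullet> \<sigma> (\<lambda>x. pd j \<phi> (inverse l *\<^sub>R x))) / 2)) +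
        l powr (2 - 2) * (axis i 1 \<bullet> B (\<lambda>x. \<phi> (inverse l *\<^sub>R x))) =
        (Div \<sigma> (\<lambda>x. \<phi> (inverse l *\<^sub>R x)) + B (\<lambda>x. \<phi> (inverse l *\<^sub>R x))) $ i"
        by (simp add: Div_def inner_axis')
    qed simp
    ultimately show ?thesis
      by (simp add: Lim_transform_eventually)
  qed
  with \<rho>(1,2) show thesis by (rule that)
qed

theorem lemma3p1:
  fixes \<Omega> :: "(real^2) set"
    and \<sigma> :: "(real^2 \<Rightarrow> real) \<Rightarrow> real^2^2"
    and B :: "(real^2 \<Rightarrow> real) \<Rightarrow> real^2"
  assumes "bounded \<Omega>" and "open \<Omega>" and "connected \<Omega>" and "0 \<in> \<Omega>"
    and "\<sigma> \<in> \<A> \<Omega> Sym" and "B \<in> \<A> \<Omega> UNIV"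
  shows "(equilibrium \<Omega> \<sigma> B \<longrightarrow> pointwise_equilibrium \<Omega> \<sigma> B) \<and>
    (div_degree \<Omega> Sym \<sigma> < -1 \<and> div_degree \<Omega> UNIV B < 0 \<longrightarrow>
      (equilibrium \<Omega> \<sigma> B \<longleftrightarrow> pointwise_equilibrium \<Omega> \<sigma> B))"
proof -
  have \<sigma>: "\<sigma> \<in> distributions \<Omega> Sym" and B: "B \<in> distributions \<Omega> UNIV"
    using assms(5,6) by (simp_all add: \<A>_def)
  have eq: "equilibrium \<Omega> \<sigma> B \<longleftrightarrow> (\<forall>i. \<forall>\<phi>\<in>test_funs \<Omega> UNIV. (Div \<sigma> \<phi> + B \<phi>) $ i = 0)"
    by (rule equilibrium_iff_components[OF \<sigma> B])
  have pw: "pointwise_equilibrium \<Omega> \<sigma> B \<longleftrightarrow>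
      (\<forall>i. \<forall>\<phi>\<in>test_funs (\<Omega> - {0}) UNIV. (Div \<sigma> \<phi> + B \<phi>) $ i = 0)"
    by (rule pointwise_equilibrium_iff_away_from_0[OF assms(2,5,6)])
  have a: "pointwise_equilibrium \<Omega> \<sigma> B" if "equilibrium \<Omega> \<sigma> B"
    using that unfolding eq pw by (metis Diff_subset test_funs_mono)
  moreover have "equilibrium \<Omega> \<sigma> B"
    if deg: "div_degree \<Omega> Sym \<sigma> < -1" "div_degree \<Omega> UNIV B < 0" and p: "pointwise_equilibrium \<Omega> \<sigma> B"
  proof -
    obtain r where r: "r > 0" "ball 0 r \<subseteq> \<Omega>" "\<And>\<phi> i. \<phi> \<in> test_funs (ball 0 r) UNIV \<Longrightarrow>
        ((\<lambda>l. (Div \<sigma> (\<lambda>x. \<phi> (inverse l *\<^sub>R x)) + B (\<lambda>x. \<phi> (inverse l *\<^sub>R x))) $ i) \<longlongrightarrow> 0) (at_right 0)"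
      by (rule tendsto_Div_plus_dilate[OF assms(2,4) \<sigma> B deg]) (rule that)
    have "(Div \<sigma> \<phi> + B \<phi>) $ i = 0" if \<phi>: "\<phi> \<in> test_funs \<Omega> UNIV" for \<phi> i
    proof (rule functional_supported_at_0_eq_0[where t = "\<lambda>\<phi>. (Div \<sigma> \<phi> + B \<phi>) $ i",
          OF r(1,2) _ _ _ _ r(3) \<phi>])
      show "finite_order_on K (\<lambda>\<phi>. (Div \<sigma> \<phi> + B \<phi>) $ i)" if "compact K" "K \<subseteq> \<Omega>" for K
        by (rule finite_order_Div_plus[OF \<sigma> B that])
      show "(Div \<sigma> \<phi> + B \<phi>) $ i = 0" if "\<phi> \<in> test_funs (\<Omega> - {0}) UNIV" for \<phi>
        using p that unfolding pw by blast
    qed (simp_all add: Div_add[OF \<sigma>] distributions_add[OF B] Div_cmult[OF \<sigma>] distributions_cmult[OF B] algebra_simps)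
    then show ?thesis unfolding eq by blast
  qed
  ultimately show ?thesis by blast
qed

end
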